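(* Every manifold with cosymplectic 3-structure with metrics of Hermitian-Norden type is flat, i.e. the curvature tensor of the Levi-Civita connection of its metric $g$ vanishes.
   Context: A manifold with almost contact 3-structure is a $(4n+3)$-dimensional manifold $M$ with three almost contact structures $(\varphi_\alpha,\xi_\alpha,\eta_\alpha)$, $\alpha=1,2,3$ (endomorphisms $\varphi_\alpha$ of $TM$, vector fields $\xi_\alpha$, 1-forms $\eta_\alpha$) satisfying $\varphi_\alpha\circ\varphi_\beta=-\delta_{\alpha\beta}I+\xi_\alpha\otimes\eta_\beta+\epsilon_{\alpha\beta\gamma}\varphi_\gamma$, $\varphi_\alpha\xi_\beta=\epsilon_{\alpha\beta\gamma}\xi_\gamma$, $\eta_\alpha\circ\varphi_\beta=\epsilon_{\alpha\beta\gamma}\eta_\gamma$, $\eta_\alpha(\xi_\beta)=\delta_{\alpha\beta}$, where $(\xi_\alpha\otimes\eta_\beta)(x)=\eta_\beta(x)\xi_\alpha$, $\delta$ is the Kronecker delta and $\epsilon_{\alpha\beta\gamma}$ the Levi-Civita symbol. A pseudo-Riemannian metric $g$ is of Hermitian-Norden type if $g(\varphi_\alpha x,\varphi_\alpha y)=\varepsilon_\alpha g(x,y)+\eta_\alpha(x)\eta_\alpha(y)$ with $(\varepsilon_1,\varepsilon_2,\varepsilon_3)=(1,-1,-1)$. The structure is cosymplectic if $F_\alpha=0$ for $\alpha=1,2,3$, where $F_\alpha(x,y,z)=g((\nabla_x\varphi_\alpha)y,z)$ and $\nabla$ is the Levi-Civita connection of $g$; equivalently, $\nabla\varphi_\alpha=\nabla\xi_\alpha=\nabla\eta_\alpha=0$.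 *)

theory Defs
  imports "HOL-Analysis.Analysis" "HOL-Library.Function_Algebras"
begin

text \<open>
  Function_Algebras supplies pointwise 0, +, - and * for real functions on the manifold, for
  tangent vectors (which are functionals on real functions) and for vector fields.
\<close>

definition scl :: "real \<Rightarrow> ('b \<Rightarrow> real) \<Rightarrow> 'b \<Rightarrow> real"  (infixr \<open>\<odot>\<close> 75)
  where "c \<odot> v = (\<lambda>x. c * v x)"

subsection \<open>Smooth manifolds\<close>

text \<open>\<open>Ck_on k S f\<close> is meant for open \<open>S\<close>: \<open>f\<close> is \<open>k\<close> times continuously differentiable on \<open>S\<close>.\<close>

primrec Ck_on ::
    "nat \<Rightarrow> 'e::euclidean_space set \<Rightarrow> ('e \<Rightarrow> 'b::real_normed_vector) \<Rightarrow> bool"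
  where
    "Ck_on 0 S f \<longleftrightarrow> continuous_on S f"
  | "Ck_on (Suc k) S f \<longleftrightarrow>
       (\<forall>x\<in>S. f differentiable (at x)) \<and>
       (\<forall>v. Ck_on k S (\<lambda>x. frechet_derivative f (at x) v))"

definition smooth_on :: "'e::euclidean_space set \<Rightarrow> ('e \<Rightarrow> 'b::real_normed_vector) \<Rightarrow> bool"
  where "smooth_on S f \<longleftrightarrow> (\<forall>k. Ck_on k S f)"

text \<open>A chart is a pair of a domain and a coordinate map; the map is irrelevant off the domain.\<close>

type_synonym ('a, 'e) chart = "'a set \<times> ('a \<Rightarrow> 'e)"

definition is_chart :: "('a::topological_space, 'e::euclidean_space) chart \<Rightarrow> bool"
  where "is_chart = (\<lambda>(U, \<psi>).
    open U \<and> open (\<psi> ` U) \<and> homeomorphism U (\<psi> ` U) \<psi> (inv_into U \<psi>))"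

text \<open>
  The manifold is the whole of the type \<open>'a\<close>, which the theorem takes to be Hausdorff and second
  countable; its dimension is \<open>DIM('e)\<close>. The atlas need not be maximal.
\<close>

definition smooth_atlas :: "('a::topological_space, 'e::euclidean_space) chart set \<Rightarrow> bool"
  where "smooth_atlas A \<longleftrightarrow>
    (\<forall>c\<in>A. is_chart c) \<and>
    (\<Union>c\<in>A. fst c) = UNIV \<and>
    (\<forall>(U, \<psi>)\<in>A. \<forall>(V, \<theta>)\<in>A. smooth_on (\<psi> ` (U \<inter> V)) (\<theta> \<circ> inv_into U \<psi>))"

definition smooth_functions ::
    "('a::topological_space, 'e::euclidean_space) chart set \<Rightarrow> ('a \<Rightarrow> real) set"
  where "smooth_functions A = {f. \<forall>(U, \<psi>)\<in>A. smooth_on (\<psi> ` U) (f \<circ> inv_into U \<psi>)}"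

text \<open>
  Tangent vectors at \<open>p\<close> are the derivations at \<open>p\<close> of the algebra of smooth functions. They are
  set to 0 on non-smooth functions, so that equality of HOL functions is equality of derivations.
\<close>

type_synonym 'a tvec = "('a \<Rightarrow> real) \<Rightarrow> real"
type_synonym 'a vfield = "'a \<Rightarrow> 'a tvec"

definition tangent_space ::
    "('a::topological_space, 'e::euclidean_space) chart set \<Rightarrow> 'a \<Rightarrow> 'a tvec set"
  where "tangent_space A p = {v.
    (\<forall>f\<in>smooth_functions A. \<forall>g\<in>smooth_functions A. v (f + g) = v f + v g) \<and>
    (\<forall>c. \<forall>f\<in>smooth_functions A. v (c \<odot> f) = c * v f) \<and>
    (\<forall>f\<in>smooth_functions A. \<forall>g\<in>smooth_functions A. v (f * g) = f p * v g + g p * v f) \<and>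
    (\<forall>f. f \<notin> smooth_functions A \<longrightarrow> v f = 0)}"

definition vector_fields ::
    "('a::topological_space, 'e::euclidean_space) chart set \<Rightarrow> 'a vfield set"
  where "vector_fields A = {X.
    (\<forall>p. X p \<in> tangent_space A p) \<and>
    (\<forall>f\<in>smooth_functions A. (\<lambda>p. X p f) \<in> smooth_functions A)}"

definition fmult :: "('a \<Rightarrow> real) \<Rightarrow> 'a vfield \<Rightarrow> 'a vfield"
  where "fmult f X = (\<lambda>p. f p \<odot> X p)"

definition lie_bracket :: "'a vfield \<Rightarrow> 'a vfield \<Rightarrow> 'a vfield"
  where "lie_bracket X Y = (\<lambda>p f. X p (\<lambda>q. Y q f) - Y p (\<lambda>q. X q f))"

subsection \<open>Tensor fields\<close>

definition endo_field ::
    "('a::topological_space, 'e::euclidean_space) chart set \<Rightarrow> ('a \<Rightarrow> 'a tvec \<Rightarrow> 'a tvec) \<Rightarrow> bool"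
  where "endo_field A \<phi> \<longleftrightarrow>
    (\<forall>p. \<forall>v\<in>tangent_space A p. \<phi> p v \<in> tangent_space A p) \<and>
    (\<forall>p. \<forall>v\<in>tangent_space A p. \<forall>w\<in>tangent_space A p. \<phi> p (v + w) = \<phi> p v + \<phi> p w) \<and>
    (\<forall>p c. \<forall>v\<in>tangent_space A p. \<phi> p (c \<odot> v) = c \<odot> \<phi> p v) \<and>
    (\<forall>X\<in>vector_fields A. (\<lambda>p. \<phi> p (X p)) \<in> vector_fields A)"

definition one_form ::
    "('a::topological_space, 'e::euclidean_space) chart set \<Rightarrow> ('a \<Rightarrow> 'a tvec \<Rightarrow> real) \<Rightarrow> bool"
  where "one_form A \<eta> \<longleftrightarrow>
    (\<forall>p. \<forall>v\<in>tangent_space A p. \<forall>w\<in>tangent_space A p. \<eta> p (v + w) = \<eta> p v + \<eta> p w) \<and>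
    (\<forall>p c. \<forall>v\<in>tangent_space A p. \<eta> p (c \<odot> v) = c * \<eta> p v) \<and>
    (\<forall>X\<in>vector_fields A. (\<lambda>p. \<eta> p (X p)) \<in> smooth_functions A)"

definition pseudo_riemannian_metric ::
    "('a::topological_space, 'e::euclidean_space) chart set \<Rightarrow>
      ('a \<Rightarrow> 'a tvec \<Rightarrow> 'a tvec \<Rightarrow> real) \<Rightarrow> bool"
  where "pseudo_riemannian_metric A g \<longleftrightarrow>
    (\<forall>p. \<forall>u\<in>tangent_space A p. \<forall>v\<in>tangent_space A p. \<forall>w\<in>tangent_space A p.
       g p (u + v) w = g p u w + g p v w) \<and>
    (\<forall>p c. \<forall>v\<in>tangent_space A p. \<forall>w\<in>tangent_space A p. g p (c \<odot> v) w = c * g p v w) \<and>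
    (\<forall>p. \<forall>v\<in>tangent_space A p. \<forall>w\<in>tangent_space A p. g p v w = g p w v) \<and>
    (\<forall>p. \<forall>v\<in>tangent_space A p. (\<forall>w\<in>tangent_space A p. g p v w = 0) \<longrightarrow> v = 0) \<and>
    (\<forall>X\<in>vector_fields A. \<forall>Y\<in>vector_fields A. (\<lambda>p. g p (X p) (Y p)) \<in> smooth_functions A)"

subsection \<open>Connections and curvature\<close>

text \<open>A connection is a function on all of \<open>'a vfield\<close> of which only the values on smooth vector
  fields are meaningful.\<close>

definition affine_connection ::
    "('a::topological_space, 'e::euclidean_space) chart set \<Rightarrow>
      ('a vfield \<Rightarrow> 'a vfield \<Rightarrow> 'a vfield) \<Rightarrow> bool"
  where "affine_connection A D \<longleftrightarrow>
    (\<forall>X\<in>vector_fields A. \<forall>Y\<in>vector_fields A. D X Y \<in> vector_fields A) \<and>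
    (\<forall>X\<in>vector_fields A. \<forall>Y\<in>vector_fields A. \<forall>Z\<in>vector_fields A.
       D (X + Y) Z = D X Z + D Y Z \<and> D X (Y + Z) = D X Y + D X Z) \<and>
    (\<forall>f\<in>smooth_functions A. \<forall>X\<in>vector_fields A. \<forall>Y\<in>vector_fields A.
       D (fmult f X) Y = fmult f (D X Y) \<and>
       D X (fmult f Y) = fmult (\<lambda>p. X p f) Y + fmult f (D X Y))"

definition levi_civita_connection ::
    "('a::topological_space, 'e::euclidean_space) chart set \<Rightarrow>
      ('a \<Rightarrow> 'a tvec \<Rightarrow> 'a tvec \<Rightarrow> real) \<Rightarrow> ('a vfield \<Rightarrow> 'a vfield \<Rightarrow> 'a vfield) \<Rightarrow> bool"
  where "levi_civita_connection A g D \<longleftrightarrow>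
    affine_connection A D \<and>
    (\<forall>X\<in>vector_fields A. \<forall>Y\<in>vector_fields A. D X Y - D Y X = lie_bracket X Y) \<and>
    (\<forall>X\<in>vector_fields A. \<forall>Y\<in>vector_fields A. \<forall>Z\<in>vector_fields A. \<forall>p.
       X p (\<lambda>q. g q (Y q) (Z q)) = g p (D X Y p) (Z p) + g p (Y p) (D X Z p))"

definition curvature ::
    "('a vfield \<Rightarrow> 'a vfield \<Rightarrow> 'a vfield) \<Rightarrow> 'a vfield \<Rightarrow> 'a vfield \<Rightarrow> 'a vfield \<Rightarrow> 'a vfield"
  where "curvature D X Y Z = D X (D Y Z) - D Y (D X Z) - D (lie_bracket X Y) Z"

definition flat_connection ::
    "('a::topological_space, 'e::euclidean_space) chart set \<Rightarrow>
      ('a vfield \<Rightarrow> 'a vfield \<Rightarrow> 'a vfield) \<Rightarrow> bool"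
  where "flat_connection A D \<longleftrightarrow>
    (\<forall>X\<in>vector_fields A. \<forall>Y\<in>vector_fields A. \<forall>Z\<in>vector_fields A. curvature D X Y Z = 0)"

definition covd_endo ::
    "('a vfield \<Rightarrow> 'a vfield \<Rightarrow> 'a vfield) \<Rightarrow> ('a \<Rightarrow> 'a tvec \<Rightarrow> 'a tvec) \<Rightarrow>
      'a vfield \<Rightarrow> 'a vfield \<Rightarrow> 'a vfield"
  where "covd_endo D \<phi> X Y = D X (\<lambda>p. \<phi> p (Y p)) - (\<lambda>p. \<phi> p (D X Y p))"

subsection \<open>Almost contact 3-structures with metrics of Hermitian-Norden type\<close>

definition kronecker :: "nat \<Rightarrow> nat \<Rightarrow> real"
  where "kronecker \<alpha> \<beta> = (if \<alpha> = \<beta> then 1 else 0)"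

definition levi_civita_symbol :: "nat \<Rightarrow> nat \<Rightarrow> nat \<Rightarrow> real"
  where "levi_civita_symbol \<alpha> \<beta> \<gamma> =
    (if (\<alpha>, \<beta>, \<gamma>) \<in> {(1, 2, 3), (2, 3, 1), (3, 1, 2)} then 1
     else if (\<alpha>, \<beta>, \<gamma>) \<in> {(1, 3, 2), (3, 2, 1), (2, 1, 3)} then -1
     else 0)"

text \<open>
  The structure tensors are indexed by \<open>{1, 2, 3}\<close>; the repeated index \<open>\<gamma>\<close> in
  \<open>\<epsilon>\<^sub>\<alpha>\<^sub>\<beta>\<^sub>\<gamma> \<phi>\<^sub>\<gamma>\<close> is summed over.
\<close>

definition almost_contact_3_structure ::
    "('a::topological_space, 'e::euclidean_space) chart set \<Rightarrow>
      (nat \<Rightarrow> 'a \<Rightarrow> 'a tvec \<Rightarrow> 'a tvec) \<Rightarrow> (nat \<Rightarrow> 'a vfield) \<Rightarrow> (nat \<Rightarrow> 'a \<Rightarrow> 'a tvec \<Rightarrow> real) \<Rightarrow> bool"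
  where "almost_contact_3_structure A \<phi> \<xi> \<eta> \<longleftrightarrow>
    (\<forall>\<alpha>\<in>{1, 2, 3}. endo_field A (\<phi> \<alpha>) \<and> \<xi> \<alpha> \<in> vector_fields A \<and> one_form A (\<eta> \<alpha>)) \<and>
    (\<forall>\<alpha>\<in>{1, 2, 3}. \<forall>\<beta>\<in>{1, 2, 3}. \<forall>p.
       (\<forall>v\<in>tangent_space A p.
          \<phi> \<alpha> p (\<phi> \<beta> p v) =
            (- kronecker \<alpha> \<beta>) \<odot> v + \<eta> \<beta> p v \<odot> \<xi> \<alpha> p
              + (\<Sum>\<gamma>\<in>{1, 2, 3}. levi_civita_symbol \<alpha> \<beta> \<gamma> \<odot> \<phi> \<gamma> p v)) \<and>
       \<phi> \<alpha> p (\<xi> \<beta> p) = (\<Sum>\<gamma>\<in>{1, 2, 3}. levi_civita_symbol \<alpha> \<beta> \<gamma> \<odot> \<xi> \<gamma> p) \<and>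
       (\<forall>v\<in>tangent_space A p.
          \<eta> \<alpha> p (\<phi> \<beta> p v) = (\<Sum>\<gamma>\<in>{1, 2, 3}. levi_civita_symbol \<alpha> \<beta> \<gamma> * \<eta> \<gamma> p v)) \<and>
       \<eta> \<alpha> p (\<xi> \<beta> p) = kronecker \<alpha> \<beta>)"

definition hn_sign :: "nat \<Rightarrow> real"
  where "hn_sign \<alpha> = (if \<alpha> = 1 then 1 else -1)"

definition hermitian_norden_type ::
    "('a::topological_space, 'e::euclidean_space) chart set \<Rightarrow>
      (nat \<Rightarrow> 'a \<Rightarrow> 'a tvec \<Rightarrow> 'a tvec) \<Rightarrow> (nat \<Rightarrow> 'a \<Rightarrow> 'a tvec \<Rightarrow> real) \<Rightarrow>
      ('a \<Rightarrow> 'a tvec \<Rightarrow> 'a tvec \<Rightarrow> real) \<Rightarrow> bool"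
  where "hermitian_norden_type A \<phi> \<eta> g \<longleftrightarrow>
    (\<forall>\<alpha>\<in>{1, 2, 3}. \<forall>p. \<forall>v\<in>tangent_space A p. \<forall>w\<in>tangent_space A p.
       g p (\<phi> \<alpha> p v) (\<phi> \<alpha> p w) = hn_sign \<alpha> * g p v w + \<eta> \<alpha> p v * \<eta> \<alpha> p w)"

definition fundamental_tensor ::
    "('a \<Rightarrow> 'a tvec \<Rightarrow> 'a tvec \<Rightarrow> real) \<Rightarrow> ('a vfield \<Rightarrow> 'a vfield \<Rightarrow> 'a vfield) \<Rightarrow>
      ('a \<Rightarrow> 'a tvec \<Rightarrow> 'a tvec) \<Rightarrow> 'a vfield \<Rightarrow> 'a vfield \<Rightarrow> 'a vfield \<Rightarrow> 'a \<Rightarrow> real"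
  where "fundamental_tensor g D \<phi> X Y Z = (\<lambda>p. g p (covd_endo D \<phi> X Y p) (Z p))"

definition cosymplectic ::
    "('a::topological_space, 'e::euclidean_space) chart set \<Rightarrow>
      (nat \<Rightarrow> 'a \<Rightarrow> 'a tvec \<Rightarrow> 'a tvec) \<Rightarrow>
      ('a \<Rightarrow> 'a tvec \<Rightarrow> 'a tvec \<Rightarrow> real) \<Rightarrow> ('a vfield \<Rightarrow> 'a vfield \<Rightarrow> 'a vfield) \<Rightarrow> bool"
  where "cosymplectic A \<phi> g D \<longleftrightarrow>
    (\<forall>\<alpha>\<in>{1, 2, 3}. \<forall>X\<in>vector_fields A. \<forall>Y\<in>vector_fields A. \<forall>Z\<in>vector_fields A.
       fundamental_tensor g D (\<phi> \<alpha>) X Y Z = 0)"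

end

theory Submission
  imports Defs
begin

text \<open>
  Let \<open>R\<close> be the curvature tensor. The structure is parallel, so each \<open>\<phi>\<^sub>\<alpha>\<close> commutes with every
  \<open>R(X, Y)\<close>. For the two Norden directions \<open>\<alpha> = 2, 3\<close> the endomorphism \<open>\<phi>\<^sub>\<alpha>\<close> is moreover
  self-adjoint for \<open>g\<close> (\<open>norden_selfadjoint\<close>), and this makes \<open>R\<close> pure: the tensor
  \<open>R(X, Y, Z, \<phi>\<^sub>\<alpha> W)\<close> has all the symmetries of a curvature tensor, in particular the pair symmetry, so
  \<open>\<phi>\<^sub>\<alpha>\<close> can be moved freely among the four slots of \<open>R\<close>. With two such
  endomorphisms, their order no longer matters on the values of \<open>R\<close>:
  \<open>\<phi>\<^sub>2 \<phi>\<^sub>3 v = \<phi>\<^sub>3 \<phi>\<^sub>2 v\<close> for \<open>v = R(X, Y) Z\<close>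
  (\<open>parallel_selfadjoint_commute_on_curvature\<close>).

  But \<open>\<phi>\<^sub>2\<close> and \<open>\<phi>\<^sub>3\<close> anticommute up to the Reeb directions, with product \<open>\<phi>\<^sub>1\<close>, so a vector on
  which they commute is a multiple of \<open>\<xi>\<^sub>1\<close> (\<open>commuting_on_vector\<close>). Thus every \<open>R(X, Y) Z\<close> is
  a multiple of \<open>\<xi>\<^sub>1\<close>. So is \<open>\<phi>\<^sub>2 (R(X, Y) Z) = R(X, Y) (\<phi>\<^sub>2 Z)\<close>, whereas \<open>\<phi>\<^sub>2 \<xi>\<^sub>1 = - \<xi>\<^sub>3\<close>; hence
  \<open>R(X, Y) Z = 0\<close>.

  This computation tests vectors against global vector fields, so it rests on the fact
  that every derivation at a point is the value of a smooth vector field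
  (\<open>tangent_vector_extends\<close>). That in turn needs smooth bump functions and
  Hadamard's lemma, and hence the calculus of \<open>C\<^sup>k\<close> functions developed first.
\<close>

section \<open>Calculus of \<open>C\<^sup>k\<close> functions on open sets\<close>

lemma Ck_on_cong:
  assumes "open S" "\<And>x. x \<in> S \<Longrightarrow> f x = h x"
  shows "Ck_on k S f \<longleftrightarrow> Ck_on k S h"
  using assms(2)
proof (induction k arbitrary: f h)
  case 0
  then show ?case by (simp cong: continuous_on_cong)
next
  case (Suc k)
  have D: "(f has_derivative f') (at x) \<longleftrightarrow> (h has_derivative f') (at x)" if "x \<in> S" for x f'
    using has_derivative_transform_within_open[OF _ assms(1) that] Suc.prems by metis
  then have F: "frechet_derivative f (at x) = frechet_derivative h (at x)" if "x \<in> S" for x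
    using that by (simp add: frechet_derivative_def)
  have "f differentiable (at x) \<longleftrightarrow> h differentiable (at x)" if "x \<in> S" for x
    using D[OF that] by (simp add: differentiable_def)
  moreover have "Ck_on k S (\<lambda>x. frechet_derivative f (at x) v) \<longleftrightarrow>
      Ck_on k S (\<lambda>x. frechet_derivative h (at x) v)" for v
    by (rule Suc.IH) (simp add: F)
  ultimately show ?case by simp
qed

text \<open>
  This form spares all later proofs the choice operator inside \<open>frechet_derivative\<close>: any family of
  derivatives will do, because derivatives at interior points are unique.
\<close>

lemma Ck_on_SucI:
  assumes "open S" "\<And>x. x \<in> S \<Longrightarrow> (f has_derivative f' x) (at x)"
    and "\<And>v. Ck_on k S (\<lambda>x. f' x v)"
  shows "Ck_on (Suc k) S f"
proof -
  have "Ck_on k S (\<lambda>x. frechet_derivative f (at x) v)" for v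
    using Ck_on_cong[OF assms(1), of "\<lambda>x. f' x v" "\<lambda>x. frechet_derivative f (at x) v" k]
      frechet_derivative_at[OF assms(2)] assms(3) by force
  then show ?thesis
    using assms(2) by (auto simp: differentiable_def)
qed

lemma Ck_on_has_derivative:
  assumes "Ck_on (Suc k) S f" "x \<in> S"
  shows "(f has_derivative frechet_derivative f (at x)) (at x)"
  using assms frechet_derivative_works by auto

lemma Ck_on_SucD: "Ck_on (Suc k) S f \<Longrightarrow> Ck_on k S f"
proof (induction k arbitrary: f)
  case 0
  then show ?case
    by (auto intro!: continuous_at_imp_continuous_on differentiable_imp_continuous_within)
qed auto

lemma Ck_on_subset: "Ck_on k S f \<Longrightarrow> T \<subseteq> S \<Longrightarrow> Ck_on k T f"
  by (induction k arbitrary: f) (auto intro: continuous_on_subset)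

lemma Ck_on_local:
  assumes "\<And>x. x \<in> S \<Longrightarrow> \<exists>T. open T \<and> x \<in> T \<and> Ck_on k T f"
  shows "Ck_on k S f"
  using assms
proof (induction k arbitrary: f)
  case 0
  show ?case unfolding Ck_on.simps
  proof (rule continuous_at_imp_continuous_on, rule ballI)
    fix x assume "x \<in> S"
    then obtain T where "open T" "x \<in> T" "continuous_on T f" using 0 by force
    then show "isCont f x" using continuous_on_eq_continuous_at by blast
  qed
next
  case (Suc k)
  have "f differentiable (at x)" if "x \<in> S" for x
    using Suc.prems[OF that] by auto
  moreover have "Ck_on k S (\<lambda>x. frechet_derivative f (at x) v)" for v
    by (rule Suc.IH) (use Suc.prems in force)
  ultimately show ?case by simp
qed

lemma Ck_on_const: "Ck_on k S (\<lambda>x. c)"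
  by (induction k arbitrary: c) auto

lemma Ck_on_bounded_linear:
  assumes "bounded_linear L" "open S"
  shows "Ck_on k S L"
proof (cases k)
  case 0
  then show ?thesis using assms by (simp add: linear_continuous_on)
next
  case (Suc m)
  show ?thesis unfolding Suc
    by (rule Ck_on_SucI[OF assms(2) bounded_linear_imp_has_derivative[OF assms(1)] Ck_on_const])
qed

lemma Ck_on_add:
  assumes "open S" "Ck_on k S f" "Ck_on k S h"
  shows "Ck_on k S (\<lambda>x. f x + h x)"
  using assms(2,3)
proof (induction k arbitrary: f h)
  case 0
  then show ?case by (auto intro: continuous_intros)
next
  case (Suc k)
  show ?case
    by (rule Ck_on_SucI[OF assms(1) has_derivative_add[OF Ck_on_has_derivative[OF Suc.prems(1)]
            Ck_on_has_derivative[OF Suc.prems(2)]]])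
      (use Suc in auto)
qed

lemma Ck_on_sum:
  assumes "open S" "finite I" "\<And>i. i \<in> I \<Longrightarrow> Ck_on k S (f i)"
  shows "Ck_on k S (\<lambda>x. \<Sum>i\<in>I. f i x)"
  using assms(2,3)
proof (induction I rule: finite_induct)
  case empty
  then show ?case by (simp add: Ck_on_const)
next
  case (insert i I)
  then have "Ck_on k S (\<lambda>x. f i x + (\<Sum>i\<in>I. f i x))"
    by (intro Ck_on_add[OF assms(1)]) auto
  then show ?case using insert by simp
qed

lemma Ck_on_scaleR:
  assumes "open S" "Ck_on k S f" "Ck_on k S h"
  shows "Ck_on k S (\<lambda>x. f x *\<^sub>R h x)"
  using assms(2,3)
proof (induction k arbitrary: f h)
  case 0
  then show ?case by (auto intro: continuous_intros)
next
  case (Suc k)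
  have "Ck_on k S f" "Ck_on k S h"
    using Suc.prems Ck_on_SucD by blast+
  then have c: "Ck_on k S (\<lambda>x. f x *\<^sub>R frechet_derivative h (at x) v +
      frechet_derivative f (at x) v *\<^sub>R h x)" for v
    using Suc by (intro Ck_on_add[OF assms(1)] Suc.IH) auto
  show ?case
    by (rule Ck_on_SucI[OF assms(1) has_derivative_scaleR[OF Ck_on_has_derivative[OF Suc.prems(1)]
            Ck_on_has_derivative[OF Suc.prems(2)]]]) (auto intro: c)
qed

lemma Ck_on_linear_image:
  assumes "open S" "bounded_linear L" "Ck_on k S f"
  shows "Ck_on k S (\<lambda>x. L (f x))"
  using assms(3)
proof (induction k arbitrary: f)
  case 0
  then show ?case using bounded_linear.continuous_on[OF assms(2)] by auto
next
  case (Suc k)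
  show ?case
    by (rule Ck_on_SucI[OF assms(1)
          bounded_linear.has_derivative[OF assms(2) Ck_on_has_derivative[OF Suc.prems]]])
      (use Suc in auto)
qed

lemma linear_eq_sum_Basis:
  fixes L :: "'e::euclidean_space \<Rightarrow> 'b::real_vector"
  assumes "linear L"
  shows "L v = (\<Sum>i\<in>Basis. (v \<bullet> i) *\<^sub>R L i)"
  using linear_sum[OF assms, of "\<lambda>i. (v \<bullet> i) *\<^sub>R i" Basis]
  by (simp add: euclidean_representation linear_scale[OF assms])

text \<open>
  The chain rule gives the derivative of \<open>h \<circ> f\<close> as \<open>Dh (f x) (Df x v)\<close>, where the direction
  \<open>Df x v\<close> depends on \<open>x\<close>, whereas the induction hypothesis covers only fixed directions. Expanding
  that vector in the basis reduces it to products of a coordinate of \<open>Df x v\<close> with \<open>Dh (f x) i\<close>.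
\<close>

lemma Ck_on_compose:
  fixes f :: "'e::euclidean_space \<Rightarrow> 'f::euclidean_space" and h :: "'f \<Rightarrow> 'b::real_normed_vector"
  assumes "open S" "open T" "f ` S \<subseteq> T" "Ck_on k S f" "Ck_on k T h"
  shows "Ck_on k S (\<lambda>x. h (f x))"
  using assms(4,5)
proof (induction k arbitrary: h)
  case 0
  then show ?case using continuous_on_compose2[of T h S f] assms(3) by auto
next
  case (Suc k)
  have f: "Ck_on k S f" using Suc.prems Ck_on_SucD by blast
  let ?D = "\<lambda>x v. frechet_derivative h (at (f x)) (frechet_derivative f (at x) v)"
  have d: "((\<lambda>x. h (f x)) has_derivative ?D x) (at x)" if "x \<in> S" for x
    using has_derivative_compose[OF Ck_on_has_derivative[OF Suc.prems(1) that]
        Ck_on_has_derivative[OF Suc.prems(2), of "f x"]] assms(3) that by auto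
  have "Ck_on k S (\<lambda>x. \<Sum>i\<in>Basis. (frechet_derivative f (at x) v \<bullet> i) *\<^sub>R
      frechet_derivative h (at (f x)) i)" for v
    using Suc by (intro Ck_on_sum Ck_on_scaleR assms(1) finite_Basis Suc.IH[OF f]
        Ck_on_linear_image[OF _ bounded_linear_inner_left]) auto
  moreover have "?D x v = (\<Sum>i\<in>Basis. (frechet_derivative f (at x) v \<bullet> i) *\<^sub>R
      frechet_derivative h (at (f x)) i)" if "x \<in> S" for x v
    using that assms(3) Ck_on_has_derivative[OF Suc.prems(2), of "f x"]
    by (intro linear_eq_sum_Basis has_derivative_linear) auto
  ultimately have c: "Ck_on k S (\<lambda>x. ?D x v)" for v
    using Ck_on_cong[OF assms(1)] by (metis (mono_tags, lifting))
  show ?case by (rule Ck_on_SucI[OF assms(1) d c])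
qed

lemma smooth_on_cong:
  "open S \<Longrightarrow> (\<And>x. x \<in> S \<Longrightarrow> f x = h x) \<Longrightarrow> smooth_on S f \<longleftrightarrow> smooth_on S h"
  using Ck_on_cong unfolding smooth_on_def by blast

lemma smooth_on_subset: "smooth_on S f \<Longrightarrow> T \<subseteq> S \<Longrightarrow> smooth_on T f"
  using Ck_on_subset unfolding smooth_on_def by blast

lemma smooth_on_local:
  "(\<And>x. x \<in> S \<Longrightarrow> \<exists>T. open T \<and> x \<in> T \<and> smooth_on T f) \<Longrightarrow> smooth_on S f"
  using Ck_on_local unfolding smooth_on_def by metis

lemma smooth_on_const: "smooth_on S (\<lambda>x. c)"
  by (simp add: smooth_on_def Ck_on_const)

lemma smooth_on_add: "open S \<Longrightarrow> smooth_on S f \<Longrightarrow> smooth_on S h \<Longrightarrow> smooth_on S (\<lambda>x. f x + h x)"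
  by (simp add: smooth_on_def Ck_on_add)

lemma smooth_on_mult:
  fixes f h :: "_ \<Rightarrow> real"
  shows "open S \<Longrightarrow> smooth_on S f \<Longrightarrow> smooth_on S h \<Longrightarrow> smooth_on S (\<lambda>x. f x * h x)"
  using Ck_on_scaleR[of S _ f h] by (simp add: smooth_on_def)

lemma smooth_on_bounded_linear: "bounded_linear L \<Longrightarrow> open S \<Longrightarrow> smooth_on S L"
  by (simp add: smooth_on_def Ck_on_bounded_linear)

lemma smooth_on_sum:
  "open S \<Longrightarrow> finite I \<Longrightarrow> (\<And>i. i \<in> I \<Longrightarrow> smooth_on S (f i)) \<Longrightarrow> smooth_on S (\<lambda>x. \<Sum>i\<in>I. f i x)"
  by (simp add: smooth_on_def Ck_on_sum)

lemma smooth_on_compose: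
  fixes f :: "'e::euclidean_space \<Rightarrow> 'f::euclidean_space"
  shows "open S \<Longrightarrow> open T \<Longrightarrow> f ` S \<subseteq> T \<Longrightarrow> smooth_on S f \<Longrightarrow> smooth_on T h \<Longrightarrow>
    smooth_on S (\<lambda>x. h (f x))"
  using Ck_on_compose unfolding smooth_on_def by blast

lemma smooth_on_derivative:
  "smooth_on S f \<Longrightarrow> smooth_on S (\<lambda>x. frechet_derivative f (at x) v)"
  unfolding smooth_on_def using Ck_on.simps(2) by blast

lemma smooth_on_has_derivative:
  "smooth_on S f \<Longrightarrow> x \<in> S \<Longrightarrow> (f has_derivative frechet_derivative f (at x)) (at x)"
  unfolding smooth_on_def using Ck_on_has_derivative by blast

lemma smooth_on_continuous_on: "smooth_on S f \<Longrightarrow> continuous_on S f"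
  unfolding smooth_on_def using Ck_on.simps(1) by blast

section \<open>Smooth bump functions\<close>

text \<open>
  The powers of \<open>1 / x\<close> make the family closed under differentiation, so that smoothness of
  \<open>exp (- 1 / x)\<close>, extended by zero, follows by induction for all members at once.
\<close>

definition flat_exp :: "nat \<Rightarrow> real \<Rightarrow> real"
  where "flat_exp n x = (if x > 0 then (1 / x) ^ n * exp (- (1 / x)) else 0)"

lemma flat_exp_over_id_tendsto_0: "((\<lambda>x. flat_exp n x / x) \<longlongrightarrow> 0) (at 0)"
proof -
  have "((\<lambda>y::real. y ^ Suc n / exp y) \<longlongrightarrow> 0) at_top"
    by (rule tendsto_power_div_exp_0)
  from filterlim_compose[OF this filterlim_inverse_at_top_right]
  have "((\<lambda>x::real. inverse x ^ Suc n / exp (inverse x)) \<longlongrightarrow> 0) (at_right 0)" .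
  then have r: "((\<lambda>x. flat_exp n x / x) \<longlongrightarrow> 0) (at_right 0)"
    by (rule Lim_transform_eventually)
      (auto simp: eventually_at_right_field flat_exp_def exp_minus divide_simps intro!: exI[of _ 1])
  have l: "((\<lambda>x. flat_exp n x / x) \<longlongrightarrow> 0) (at_left 0)"
    by (rule Lim_transform_eventually[OF tendsto_const])
      (auto simp: eventually_at_left_field flat_exp_def intro!: exI[of _ "-1"])
  show ?thesis using r l by (simp add: filterlim_at_split)
qed

lemma flat_exp_has_derivative:
  "(flat_exp n has_real_derivative flat_exp (n + 2) x - real n * flat_exp (n + 1) x) (at x)"
proof -
  consider "x > 0" | "x < 0" | "x = 0" by linarith
  then show ?thesis
  proof cases
    case 1
    have "((\<lambda>x. (1 / x) ^ n * exp (- (1 / x))) has_real_derivative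
        real n * (1 / x) ^ (n - 1) * (- (1 / x\<^sup>2)) * exp (- (1 / x)) +
        (1 / x) ^ n * (exp (- (1 / x)) * (1 / x\<^sup>2))) (at x)"
      using 1 by (auto intro!: derivative_eq_intros simp: power2_eq_square)
    moreover have "real n * (1 / x) ^ (n - 1) * (- (1 / x\<^sup>2)) * exp (- (1 / x)) +
        (1 / x) ^ n * (exp (- (1 / x)) * (1 / x\<^sup>2)) =
        flat_exp (n + 2) x - real n * flat_exp (n + 1) x"
      using 1 by (cases n) (auto simp: flat_exp_def power_divide power2_eq_square algebra_simps)
    ultimately have "((\<lambda>x. (1 / x) ^ n * exp (- (1 / x))) has_real_derivative
        flat_exp (n + 2) x - real n * flat_exp (n + 1) x) (at x)" by simp
    then show ?thesis
      by (rule has_field_derivative_transform_within_open[where S = "{0<..}"])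
        (use 1 in \<open>auto simp: flat_exp_def\<close>)
  next
    case 2
    have "((\<lambda>x. 0) has_real_derivative flat_exp (n + 2) x - real n * flat_exp (n + 1) x) (at x)"
      using 2 by (auto simp: flat_exp_def)
    then show ?thesis
      by (rule has_field_derivative_transform_within_open[where S = "{..<0}"])
        (use 2 in \<open>auto simp: flat_exp_def\<close>)
  next
    case 3
    then show ?thesis using flat_exp_over_id_tendsto_0[of n]
      by (simp add: has_field_derivative_iff flat_exp_def)
  qed
qed

lemma smooth_on_flat_exp: "smooth_on UNIV (flat_exp n)"
  unfolding smooth_on_def
proof
  fix k show "Ck_on k UNIV (flat_exp n)"
  proof (induction k arbitrary: n)
    case 0
    show ?case
      using DERIV_isCont[OF flat_exp_has_derivative] by (simp add: continuous_at_imp_continuous_on)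
  next
    case (Suc k)
    have d: "Ck_on k UNIV (\<lambda>x. v * flat_exp (n + 2) x + (- (v * real n)) * flat_exp (n + 1) x)" for v
      by (intro Ck_on_add Ck_on_scaleR[where 'b = real, unfolded real_scaleR_def] Ck_on_const
          Suc.IH open_UNIV)
    show ?case
    proof (rule Ck_on_SucI[where f' = "\<lambda>x v. (flat_exp (n + 2) x - real n * flat_exp (n + 1) x) * v"])
      show "(flat_exp n has_derivative (\<lambda>v. (flat_exp (n + 2) x - real n * flat_exp (n + 1) x) * v))
          (at x)" for x
        using flat_exp_has_derivative[of n x] by (simp add: has_field_derivative_def)
      show "Ck_on k UNIV (\<lambda>x. (flat_exp (n + 2) x - real n * flat_exp (n + 1) x) * v)" for v
        using d[of v] by (simp add: algebra_simps)
    qed simp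
  qed
qed

text \<open>
  The value 1 at the centre makes \<open>\<rho>\<close> invisible to derivations at \<open>a\<close>: on a function vanishing
  at \<open>a\<close> they do not change their value when it is multiplied by \<open>\<rho>\<close>.
\<close>

lemma smooth_bump_exists:
  fixes a :: "'e::euclidean_space"
  assumes "s > 0"
  obtains \<rho> :: "'e \<Rightarrow> real"
    where "smooth_on UNIV \<rho>" "\<rho> a = 1" "\<And>x. x \<notin> cball a s \<Longrightarrow> \<rho> x = 0"
proof -
  (* The argument of the flat function is s^2 - |x - a|^2, the factor normalizes the value at a. *)
  define \<rho> where "\<rho> x = exp (1 / s\<^sup>2) * flat_exp 0 (s\<^sup>2 + (x - a) \<bullet> (a - x))" for x
  have "smooth_on UNIV (\<lambda>x. (x - a) \<bullet> i)" for i
    using smooth_on_add[OF _ smooth_on_bounded_linear[OF bounded_linear_inner_left[of i], of UNIV]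
        smooth_on_const[of UNIV "- (a \<bullet> i)"]]
    by (simp add: inner_diff_left)
  then have "smooth_on UNIV (\<lambda>x. s\<^sup>2 + (\<Sum>i\<in>Basis. ((x - a) \<bullet> i) * ((-1) * ((x - a) \<bullet> i))))"
    by (intro smooth_on_add smooth_on_sum smooth_on_mult smooth_on_const) auto
  moreover have "s\<^sup>2 + (\<Sum>i\<in>Basis. ((x - a) \<bullet> i) * ((-1) * ((x - a) \<bullet> i))) = s\<^sup>2 + (x - a) \<bullet> (a - x)"
    for x
    by (subst euclidean_inner) (simp add: inner_diff_left right_diff_distrib sum_negf)
  ultimately have "smooth_on UNIV (\<lambda>x. s\<^sup>2 + (x - a) \<bullet> (a - x))" by simp
  from smooth_on_compose[OF _ _ _ this smooth_on_flat_exp[of 0]]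
  have "smooth_on UNIV \<rho>"
    unfolding \<rho>_def by (intro smooth_on_mult smooth_on_const) auto
  moreover have "\<rho> a = 1"
    using assms by (simp add: \<rho>_def flat_exp_def flip: exp_add)
  moreover have "\<rho> x = 0" if "x \<notin> cball a s" for x
  proof -
    have "s\<^sup>2 < (norm (x - a))\<^sup>2"
      using that assms by (intro power_strict_mono) (auto simp: dist_norm norm_minus_commute)
    then have "s\<^sup>2 + (x - a) \<bullet> (a - x) \<le> 0"
      by (simp add: power2_norm_eq_inner inner_diff_right inner_diff_left)
    then show ?thesis by (simp add: \<rho>_def flat_exp_def)
  qed
  ultimately show ?thesis using that by blast
qed

section \<open>Hadamard's lemma\<close>

lemma radial_in_ball:
  fixes a :: "'e::euclidean_space"
  assumes "x \<in> ball a r" "t \<in> {0..1::real}"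
  shows "a + t *\<^sub>R (x - a) \<in> ball a r"
proof -
  have "t * norm (x - a) \<le> norm (x - a)" using assms mult_right_mono[of t 1] by simp
  then show ?thesis using assms by (simp add: dist_norm norm_minus_commute)
qed

lemma continuous_on_segment:
  fixes a :: "'e::euclidean_space"
  assumes "continuous_on (ball a r) f" "x \<in> ball a r"
  shows "continuous_on {0..1::real} (\<lambda>t. f (a + t *\<^sub>R (x - a)))"
  by (rule continuous_on_compose2[OF assms(1)])
    (use radial_in_ball[OF assms(2)] in \<open>auto intro!: continuous_intros\<close>)

lemma continuous_on_radial:
  fixes a :: "'e::euclidean_space" and f :: "'e \<Rightarrow> real"
  assumes "continuous_on (ball a r) f"
  shows "continuous_on (ball a r \<times> {0..1}) (\<lambda>(x, t). t ^ j * f (a + t *\<^sub>R (x - a)))"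
proof -
  have "(\<lambda>z. a + snd z *\<^sub>R (fst z - a)) ` (ball a r \<times> {0..1}) \<subseteq> ball a r"
    using radial_in_ball by fastforce
  then have "continuous_on (ball a r \<times> {0..1}) (\<lambda>z. f (a + snd z *\<^sub>R (fst z - a)))"
    by (intro continuous_on_compose2[OF assms] continuous_intros)
  then show ?thesis
    by (auto simp: split_beta intro!: continuous_intros)
qed

text \<open>
  Differentiation under the integral sign. The weight \<open>t ^ j\<close> makes the statement iterable:
  each derivative of \<open>f (a + t *\<^sub>R (x - a))\<close> in \<open>x\<close> yields one more factor \<open>t\<close>.
\<close>

lemma integral_radial_has_derivative:
  fixes a :: "'e::euclidean_space" and f :: "'e \<Rightarrow> real"
  assumes "Ck_on (Suc k) (ball a r) f" "x \<in> ball a r"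
  shows "((\<lambda>x. integral {0..1} (\<lambda>t. t ^ j * f (a + t *\<^sub>R (x - a)))) has_derivative
    (\<lambda>v. integral {0..1} (\<lambda>t. t ^ Suc j * frechet_derivative f (at (a + t *\<^sub>R (x - a))) v))) (at x)"
proof -
  let ?B = "ball a r"
  define D where "D y v = frechet_derivative f (at y) v" for y v
  have D: "(f has_derivative D y) (at y)" if "y \<in> ?B" for y
    using Ck_on_has_derivative[OF assms(1) that] unfolding D_def by (simp add: eta_contract_eq)
  have Dc: "continuous_on ?B (\<lambda>y. D y v)" for v
    using assms(1) Ck_on_SucD[of 0] unfolding D_def
    by (induction k) (auto, metis Ck_on.simps(2) Ck_on_SucD)
  (* The Leibniz rule needs the derivative as a bounded linear map depending continuously on the
     parameters; as a combination of coordinate functionals this continuity is visible. *)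
  define fx where "fx x t = (\<Sum>i\<in>Basis. (t ^ Suc j * D (a + t *\<^sub>R (x - a)) i) *\<^sub>R
    blinfun_inner_left i)" for x t
  have fx: "blinfun_apply (fx x t) v = t ^ Suc j * D (a + t *\<^sub>R (x - a)) v"
    if "x \<in> ?B" "t \<in> {0..1}" for x t v
  proof -
    have "linear (D (a + t *\<^sub>R (x - a)))"
      using D[OF radial_in_ball[OF that]] has_derivative_linear by blast
    from linear_eq_sum_Basis[OF this, of v] show ?thesis
      by (simp add: fx_def blinfun.sum_left blinfun.scaleR_left sum_distrib_left algebra_simps)
  qed
  have fxc: "continuous_on (?B \<times> cbox 0 1) (\<lambda>(x, t). fx x t)"
    unfolding fx_def split_beta cbox_interval
    by (intro continuous_on_sum continuous_on_scaleR continuous_on_const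
        continuous_on_radial[OF Dc, unfolded split_beta])
  have L: "((\<lambda>x. integral (cbox 0 1) (\<lambda>t. t ^ j * f (a + t *\<^sub>R (x - a)))) has_derivative
      integral (cbox 0 1) (fx x)) (at x within ?B)"
  proof (rule leibniz_rule[OF _ _ fxc assms(2) convex_ball])
    fix x and t :: real assume xt: "x \<in> ?B" "t \<in> cbox 0 1"
    have "((\<lambda>x. f (a + t *\<^sub>R (x - a))) has_derivative (\<lambda>v. D (a + t *\<^sub>R (x - a)) (t *\<^sub>R v))) (at x)"
      using radial_in_ball[of x a r t] xt
      by (intro has_derivative_compose[OF _ D]) (auto intro!: derivative_eq_intros)
    then have "((\<lambda>x. t ^ j * f (a + t *\<^sub>R (x - a))) has_derivative
        (\<lambda>v. t ^ j * D (a + t *\<^sub>R (x - a)) (t *\<^sub>R v))) (at x)"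
      by (rule has_derivative_mult_right)
    moreover have "(\<lambda>v. t ^ j * D (a + t *\<^sub>R (x - a)) (t *\<^sub>R v)) = blinfun_apply (fx x t)"
    proof
      fix v
      have "linear (D (a + t *\<^sub>R (x - a)))"
        using D[OF radial_in_ball[of x a r t]] has_derivative_linear xt by auto
      then show "t ^ j * D (a + t *\<^sub>R (x - a)) (t *\<^sub>R v) = blinfun_apply (fx x t) v"
        using fx[of x t v] xt by (simp add: linear_scale)
    qed
    ultimately show "((\<lambda>x. t ^ j * f (a + t *\<^sub>R (x - a))) has_derivative blinfun_apply (fx x t))
        (at x within ?B)"
      by (simp add: has_derivative_at_withinI)
  next
    fix x assume x: "x \<in> ?B"
    have "continuous_on ?B f"
      using D has_derivative_continuous continuous_at_imp_continuous_on by blast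
    from continuous_on_segment[OF this x]
    show "(\<lambda>t. t ^ j * f (a + t *\<^sub>R (x - a))) integrable_on cbox 0 1"
      by (intro integrable_continuous) (auto intro!: continuous_intros)
  qed
  have "blinfun_apply (integral (cbox 0 1) (fx x)) v =
      integral {0..1} (\<lambda>t. t ^ Suc j * D (a + t *\<^sub>R (x - a)) v)" for v
  proof -
    have "continuous_on (cbox 0 1) (fx x)"
      using continuous_on_compose2[OF fxc continuous_on_Pair[OF continuous_on_const continuous_on_id],
          of x "cbox 0 1"] assms(2)
      by (auto simp: image_subset_iff)
    then have "blinfun_apply (integral (cbox 0 1) (fx x)) v =
        integral (cbox 0 1) (\<lambda>t. blinfun_apply (fx x t) v)"
      by (intro integral_linear[symmetric, unfolded o_def] integrable_continuous
          blinfun.bounded_linear_left)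
    also have "\<dots> = integral {0..1} (\<lambda>t. t ^ Suc j * D (a + t *\<^sub>R (x - a)) v)"
      using fx[OF assms(2)] by (auto intro!: Henstock_Kurzweil_Integration.integral_cong)
    finally show ?thesis .
  qed
  then have "blinfun_apply (integral (cbox 0 1) (fx x)) =
      (\<lambda>v. integral {0..1} (\<lambda>t. t ^ Suc j * D (a + t *\<^sub>R (x - a)) v))" by blast
  with L show ?thesis
    by (simp only: at_within_open[OF assms(2) open_ball] D_def cbox_interval)
qed

lemma Ck_on_integral_radial:
  fixes a :: "'e::euclidean_space" and f :: "'e \<Rightarrow> real"
  assumes "Ck_on k (ball a r) f"
  shows "Ck_on k (ball a r) (\<lambda>x. integral {0..1} (\<lambda>t. t ^ j * f (a + t *\<^sub>R (x - a))))"
  using assms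
proof (induction k arbitrary: f j)
  case 0
  then show ?case
    using integral_continuous_on_param[of "ball a r" 0 1 "\<lambda>x t. t ^ j * f (a + t *\<^sub>R (x - a))"]
      continuous_on_radial[of a r f j] by simp
next
  case (Suc k)
  show ?case
    by (rule Ck_on_SucI[OF open_ball integral_radial_has_derivative[OF Suc.prems]])
      (use Suc in \<open>auto simp del: power_Suc\<close>)
qed

text \<open>
  \<open>f x - f a\<close> is the integral of the derivative of \<open>f\<close> along the segment from \<open>a\<close> to \<open>x\<close>; the
  factors \<open>h i\<close> are the averages of the partial derivatives along that segment.
\<close>

lemma hadamard_lemma:
  fixes a :: "'e::euclidean_space" and f :: "'e \<Rightarrow> real"
  assumes f: "smooth_on (ball a r) f" and r: "r > 0"
  obtains h where "\<And>i. smooth_on (ball a r) (h i)"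
    "\<And>x. x \<in> ball a r \<Longrightarrow> f x = f a + (\<Sum>i\<in>Basis. ((x - a) \<bullet> i) * h i x)"
    "\<And>i. h i a = frechet_derivative f (at a) i"
proof
  define D where "D y v = frechet_derivative f (at y) v" for y v
  define h where "h i x = integral {0..1} (\<lambda>t. t ^ 0 * D (a + t *\<^sub>R (x - a)) i)" for i x
  have Ds: "smooth_on (ball a r) (\<lambda>y. D y i)" for i
    unfolding D_def by (rule smooth_on_derivative[OF f])
  then show "smooth_on (ball a r) (h i)" for i
    unfolding h_def smooth_on_def using Ck_on_integral_radial by blast
  show "h i a = frechet_derivative f (at a) i" for i
    by (simp add: h_def D_def)
  fix x assume x: "x \<in> ball a r"
  have D: "(f has_derivative D y) (at y)" if "y \<in> ball a r" for y
    using smooth_on_has_derivative[OF f that] unfolding D_def by (simp add: eta_contract_eq)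
  have "((\<lambda>t. f (a + t *\<^sub>R (x - a))) has_vector_derivative D (a + t *\<^sub>R (x - a)) (x - a))
      (at t within {0..1})" if t: "t \<in> {0..1}" for t
  proof -
    have "((\<lambda>t. f (a + t *\<^sub>R (x - a))) has_derivative (\<lambda>s. D (a + t *\<^sub>R (x - a)) (s *\<^sub>R (x - a)))) (at t)"
      using radial_in_ball[OF x t]
      by (intro has_derivative_compose[OF _ D]) (auto intro!: derivative_eq_intros)
    moreover have "linear (D (a + t *\<^sub>R (x - a)))"
      using D[OF radial_in_ball[OF x t]] has_derivative_linear by blast
    ultimately show ?thesis
      by (simp add: has_vector_derivative_def linear_scale has_derivative_at_withinI)
  qed
  then have "((\<lambda>t. D (a + t *\<^sub>R (x - a)) (x - a)) has_integral f x - f a) {0..1}"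
    using fundamental_theorem_of_calculus[of 0 1 "\<lambda>t. f (a + t *\<^sub>R (x - a))"] by force
  then have "f x - f a = integral {0..1} (\<lambda>t. D (a + t *\<^sub>R (x - a)) (x - a))"
    by (simp add: integral_unique)
  also have "\<dots> = integral {0..1} (\<lambda>t. \<Sum>i\<in>Basis. ((x - a) \<bullet> i) * D (a + t *\<^sub>R (x - a)) i)"
  proof (rule Henstock_Kurzweil_Integration.integral_cong)
    fix t :: real assume "t \<in> {0..1}"
    then have "linear (D (a + t *\<^sub>R (x - a)))"
      using D[OF radial_in_ball[OF x]] has_derivative_linear by blast
    from linear_eq_sum_Basis[OF this, of "x - a"]
    show "D (a + t *\<^sub>R (x - a)) (x - a) = (\<Sum>i\<in>Basis. ((x - a) \<bullet> i) * D (a + t *\<^sub>R (x - a)) i)"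
      by simp
  qed
  also have "\<dots> = (\<Sum>i\<in>Basis. ((x - a) \<bullet> i) * h i x)"
  proof -
    have "continuous_on {0..1} (\<lambda>t. D (a + t *\<^sub>R (x - a)) i)" for i
      by (rule continuous_on_segment[OF smooth_on_continuous_on[OF Ds] x])
    then show ?thesis
      by (subst integral_sum)
        (auto simp: h_def intro!: integrable_continuous_interval continuous_intros)
  qed
  finally show "f x = f a + (\<Sum>i\<in>Basis. ((x - a) \<bullet> i) * h i x)" by simp
qed

section \<open>Functions and vector fields supported in a chart\<close>

lemma fun_diff_eq_add_scl: "f - h = f + (-1) \<odot> h"
  by (auto simp: scl_def)

lemma sum_fun_apply:
  fixes f :: "'i \<Rightarrow> 'a \<Rightarrow> real"
  shows "(\<Sum>i\<in>I. f i) q = (\<Sum>i\<in>I. f i q)"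
  by (induction I rule: infinite_finite_induct) auto

locale smooth_manifold =
  fixes A :: "('a::t2_space, 'e::euclidean_space) chart set"
  assumes atlas: "smooth_atlas A"
begin

lemma
  assumes "(U, \<psi>) \<in> A"
  shows chart_open: "open U"
    and chart_image_open: "open (\<psi> ` U)"
    and chart_homeomorphism: "homeomorphism U (\<psi> ` U) \<psi> (inv_into U \<psi>)"
  using assms atlas unfolding smooth_atlas_def is_chart_def by auto

lemma inv_chart: "(U, \<psi>) \<in> A \<Longrightarrow> q \<in> U \<Longrightarrow> inv_into U \<psi> (\<psi> q) = q"
  using chart_homeomorphism homeomorphism_apply1 by blast

lemma transition_smooth:
  "(U, \<psi>) \<in> A \<Longrightarrow> (V, \<theta>) \<in> A \<Longrightarrow> smooth_on (\<psi> ` (U \<inter> V)) (\<theta> \<circ> inv_into U \<psi>)"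
  using atlas unfolding smooth_atlas_def by blast

lemma chart_at:
  obtains U \<psi> where "(U, \<psi>) \<in> A" "p \<in> U"
proof -
  have "p \<in> (\<Union>c\<in>A. fst c)" using atlas by (simp add: smooth_atlas_def)
  then show ?thesis using that by force
qed

lemma open_chart_image:
  assumes "(U, \<psi>) \<in> A" "open W" "W \<subseteq> U"
  shows "open (\<psi> ` W)"
  using homeomorphism_imp_open_map[OF chart_homeomorphism[OF assms(1)], of W]
    openin_open_eq[OF chart_open[OF assms(1)]] openin_open_eq[OF chart_image_open[OF assms(1)]] assms
  by auto

lemma open_chart_preimage:
  assumes "(U, \<psi>) \<in> A" "open B"
  shows "open {q \<in> U. \<psi> q \<in> B}"
  using continuous_open_preimage[OF homeomorphism_cont1[OF chart_homeomorphism[OF assms(1)]]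
      chart_open[OF assms(1)] assms(2)]
  by (simp add: vimage_def Int_def)

lemma smooth_functionsD:
  "f \<in> smooth_functions A \<Longrightarrow> (U, \<psi>) \<in> A \<Longrightarrow> smooth_on (\<psi> ` U) (\<lambda>x. f (inv_into U \<psi> x))"
  unfolding smooth_functions_def by (auto simp: o_def)

lemma smooth_functionsI:
  "(\<And>U \<psi>. (U, \<psi>) \<in> A \<Longrightarrow> smooth_on (\<psi> ` U) (\<lambda>x. f (inv_into U \<psi> x))) \<Longrightarrow> f \<in> smooth_functions A"
  unfolding smooth_functions_def by (auto simp: o_def)

lemma smooth_functions_const: "(\<lambda>q. c) \<in> smooth_functions A"
  by (rule smooth_functionsI) (rule smooth_on_const)

lemma smooth_functions_add:
  "f \<in> smooth_functions A \<Longrightarrow> h \<in> smooth_functions A \<Longrightarrow> f + h \<in> smooth_functions A"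
  by (rule smooth_functionsI) (simp add: smooth_on_add smooth_functionsD chart_image_open)

lemma smooth_functions_mult:
  "f \<in> smooth_functions A \<Longrightarrow> h \<in> smooth_functions A \<Longrightarrow> f * h \<in> smooth_functions A"
  by (rule smooth_functionsI) (simp add: smooth_on_mult smooth_functionsD chart_image_open)

lemma smooth_functions_scl: "f \<in> smooth_functions A \<Longrightarrow> c \<odot> f \<in> smooth_functions A"
  by (rule smooth_functionsI)
    (simp add: scl_def smooth_on_mult smooth_functionsD smooth_on_const chart_image_open)

lemma smooth_functions_sum:
  "finite I \<Longrightarrow> (\<And>i. i \<in> I \<Longrightarrow> f i \<in> smooth_functions A) \<Longrightarrow> (\<Sum>i\<in>I. f i) \<in> smooth_functions A"
proof (induction I rule: finite_induct)
  case empty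
  then show ?case using smooth_functions_const[of 0] by (simp add: zero_fun_def)
next
  case (insert i I)
  then show ?case using smooth_functions_add by (simp only: sum.insert[OF insert.hyps]) blast
qed

definition extend_by_zero :: "'a set \<Rightarrow> ('a \<Rightarrow> 'e) \<Rightarrow> 'e set \<Rightarrow> ('e \<Rightarrow> real) \<Rightarrow> 'a \<Rightarrow> real"
  where "extend_by_zero U \<psi> K u q = (if q \<in> U \<and> \<psi> q \<in> K then u (\<psi> q) else 0)"

text \<open>
  In a Hausdorff space the compact set \<open>inv_into U \<psi> ` K\<close> is closed. Hence the whole manifold is covered by two
  open sets: the preimage of \<open>B\<close>, where the function is \<open>u \<circ> \<psi>\<close>, and the complement of
  the compact set, where it vanishes.
\<close>

lemma extend_by_zero_smooth:
  assumes U: "(U, \<psi>) \<in> A" and K: "compact K" "K \<subseteq> B" and B: "open B" "B \<subseteq> \<psi> ` U"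
    and u: "smooth_on B u" "\<And>x. x \<in> B - K \<Longrightarrow> u x = 0"
  shows "extend_by_zero U \<psi> K u \<in> smooth_functions A"
proof (rule smooth_functionsI, rule smooth_on_local)
  fix V \<theta> x assume V: "(V, \<theta>) \<in> A" and "x \<in> \<theta> ` V"
  then obtain q where q: "q \<in> V" "x = \<theta> q" by blast
  let ?F = "\<lambda>x. extend_by_zero U \<psi> K u (inv_into V \<theta> x)"
  have K': "inv_into U \<psi> ` K = {q \<in> U. \<psi> q \<in> K}"
  proof (intro equalityI subsetI)
    fix q assume "q \<in> inv_into U \<psi> ` K"
    then obtain s where s: "s \<in> U" "\<psi> s \<in> K" "q = inv_into U \<psi> (\<psi> s)" using K B by blast
    then show "q \<in> {q \<in> U. \<psi> q \<in> K}" using inv_chart[OF U s(1)] by simp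
  next
    fix q assume "q \<in> {q \<in> U. \<psi> q \<in> K}"
    then show "q \<in> inv_into U \<psi> ` K" using inv_chart[OF U] by (intro image_eqI[of _ _ "\<psi> q"]) auto
  qed
  have "compact (inv_into U \<psi> ` K)"
    using continuous_on_subset[OF homeomorphism_cont2[OF chart_homeomorphism[OF U]]] K B
    by (intro compact_continuous_image) blast+
  then have cl: "closed {q \<in> U. \<psi> q \<in> K}"
    unfolding K' by (rule compact_imp_closed)
  show "\<exists>T. open T \<and> x \<in> T \<and> smooth_on T ?F"
  proof (cases "q \<in> U \<and> \<psi> q \<in> B")
    case True
    define W where "W = V \<inter> {q \<in> U. \<psi> q \<in> B}"
    have W: "open (\<theta> ` W)"
      unfolding W_def
      by (intro open_chart_image[OF V] open_Int chart_open[OF V] open_chart_preimage[OF U B(1)]) auto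
    have "smooth_on (\<theta> ` W) (\<lambda>x. u ((\<psi> \<circ> inv_into V \<theta>) x))"
      by (rule smooth_on_compose[OF W B(1) _ smooth_on_subset[OF transition_smooth[OF V U]] u(1)])
        (auto simp: W_def inv_chart[OF V])
    moreover have "?F x = u ((\<psi> \<circ> inv_into V \<theta>) x)" if "x \<in> \<theta> ` W" for x
      using that u(2) by (auto simp: W_def inv_chart[OF V] extend_by_zero_def)
    ultimately have "smooth_on (\<theta> ` W) ?F"
      using iffD2[OF smooth_on_cong[OF W, of ?F "\<lambda>x. u ((\<psi> \<circ> inv_into V \<theta>) x)"]] by simp
    moreover have "x \<in> \<theta> ` W" using q True by (simp add: W_def)
    ultimately show ?thesis using W by (intro exI[of _ "\<theta> ` W"] conjI)
  next
    case False
    define W where "W = V - {q \<in> U. \<psi> q \<in> K}"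
    have W: "open (\<theta> ` W)"
      unfolding W_def by (intro open_chart_image[OF V] open_Diff chart_open[OF V] cl) auto
    have "?F x = 0" if "x \<in> \<theta> ` W" for x
      using that by (auto simp: W_def inv_chart[OF V] extend_by_zero_def)
    then have "smooth_on (\<theta> ` W) ?F"
      using iffD2[OF smooth_on_cong[OF W, of ?F "\<lambda>_. 0"], OF _ smooth_on_const] by simp
    moreover have "x \<in> \<theta> ` W" using q False K(2) by (auto simp: W_def)
    ultimately show ?thesis using W by (intro exI[of _ "\<theta> ` W"] conjI)
  qed
qed

lemma
  assumes "v \<in> tangent_space A p"
  shows tangent_add: "f \<in> smooth_functions A \<Longrightarrow> h \<in> smooth_functions A \<Longrightarrow> v (f + h) = v f + v h"
    and tangent_scl: "f \<in> smooth_functions A \<Longrightarrow> v (c \<odot> f) = c * v f"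
    and tangent_mult: "f \<in> smooth_functions A \<Longrightarrow> h \<in> smooth_functions A \<Longrightarrow>
      v (f * h) = f p * v h + h p * v f"
    and tangent_nonsmooth: "f \<notin> smooth_functions A \<Longrightarrow> v f = 0"
  using assms unfolding tangent_space_def by auto

lemma tangent_const:
  assumes "v \<in> tangent_space A p"
  shows "v (\<lambda>q. c) = 0"
proof -
  have "v ((\<lambda>q. 1) * (\<lambda>q. 1)) = 2 * v (\<lambda>q. 1)"
    by (subst tangent_mult[OF assms]) (simp_all add: smooth_functions_const)
  moreover have "((\<lambda>q. 1) * (\<lambda>q. 1)) = ((\<lambda>q. 1) :: 'a \<Rightarrow> real)" by auto
  ultimately have "v (\<lambda>q. 1) = 0" by simp
  then show ?thesis
    using tangent_scl[OF assms smooth_functions_const, of c 1] by (simp add: scl_def)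
qed

lemma tangent_sum:
  assumes "v \<in> tangent_space A p" "finite I" "\<And>i. i \<in> I \<Longrightarrow> f i \<in> smooth_functions A"
  shows "v (\<Sum>i\<in>I. f i) = (\<Sum>i\<in>I. v (f i))"
  using assms(2,3)
proof (induction I rule: finite_induct)
  case empty
  then show ?case using tangent_const[OF assms(1), of 0] by (simp add: zero_fun_def)
next
  case (insert i I)
  have "v (\<Sum>i\<in>insert i I. f i) = v (f i + (\<Sum>i\<in>I. f i))"
    by (simp only: sum.insert[OF insert.hyps])
  also have "\<dots> = v (f i) + v (\<Sum>i\<in>I. f i)"
    using insert by (intro tangent_add[OF assms(1)] smooth_functions_sum) auto
  also have "\<dots> = (\<Sum>i\<in>insert i I. v (f i))"
    using insert by simp
  finally show ?case .
qed

lemma tangent_space_zero: "0 \<in> tangent_space A p"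
  by (simp add: tangent_space_def)

lemma tangent_space_add:
  "v \<in> tangent_space A p \<Longrightarrow> w \<in> tangent_space A p \<Longrightarrow> v + w \<in> tangent_space A p"
  unfolding tangent_space_def by (simp add: algebra_simps)

lemma tangent_space_diff:
  "v \<in> tangent_space A p \<Longrightarrow> w \<in> tangent_space A p \<Longrightarrow> v - w \<in> tangent_space A p"
  unfolding tangent_space_def by (simp add: algebra_simps)

lemma tangent_space_scl: "v \<in> tangent_space A p \<Longrightarrow> c \<odot> v \<in> tangent_space A p"
  unfolding tangent_space_def by (simp add: scl_def algebra_simps)

lemma field_at: "X \<in> vector_fields A \<Longrightarrow> X p \<in> tangent_space A p"
  by (simp add: vector_fields_def)

lemma field_apply_smooth:
  "X \<in> vector_fields A \<Longrightarrow> f \<in> smooth_functions A \<Longrightarrow> (\<lambda>p. X p f) \<in> smooth_functions A"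
  by (simp add: vector_fields_def)

lemma smooth_functions_diff:
  "f \<in> smooth_functions A \<Longrightarrow> h \<in> smooth_functions A \<Longrightarrow> f - h \<in> smooth_functions A"
  unfolding fun_diff_eq_add_scl by (intro smooth_functions_add smooth_functions_scl)

lemma tangent_diff:
  assumes "v \<in> tangent_space A p" "f \<in> smooth_functions A" "h \<in> smooth_functions A"
  shows "v (f - h) = v f - v h"
  unfolding fun_diff_eq_add_scl[of f] using assms
  by (simp only: tangent_add tangent_scl smooth_functions_scl)

lemma fields_diff:
  assumes "X \<in> vector_fields A" "Y \<in> vector_fields A"
  shows "X - Y \<in> vector_fields A"
proof -
  have "(\<lambda>p. X p f - Y p f) \<in> smooth_functions A" if "f \<in> smooth_functions A" for f
    using smooth_functions_diff[OF field_apply_smooth field_apply_smooth, OF assms(1) that assms(2) that]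
    by (simp add: fun_diff_def)
  then show ?thesis
    using assms tangent_space_diff by (simp add: vector_fields_def)
qed

lemma coordinate_derivation:
  assumes U: "(U, \<psi>) \<in> A" and q: "q \<in> U"
  shows "(\<lambda>f. if f \<in> smooth_functions A
      then k * frechet_derivative (\<lambda>x. f (inv_into U \<psi> x)) (at (\<psi> q)) c else 0) \<in> tangent_space A q"
    (is "?v \<in> _")
proof -
  let ?i = "inv_into U \<psi>"
  let ?D = "\<lambda>f. frechet_derivative (\<lambda>x. f (?i x)) (at (\<psi> q))"
  have D: "((\<lambda>x. f (?i x)) has_derivative ?D f) (at (\<psi> q))" if "f \<in> smooth_functions A"
    for f :: "'a \<Rightarrow> real"
    using smooth_on_has_derivative[OF smooth_functionsD[OF that U]] q by blast
  have "?D (f + h) = (\<lambda>c. ?D f c + ?D h c)"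
    if "f \<in> smooth_functions A" "h \<in> smooth_functions A" for f h :: "'a \<Rightarrow> real"
    using frechet_derivative_at[OF has_derivative_add[OF D[OF that(1)] D[OF that(2)]]] by simp
  moreover have "?D (b \<odot> f) = (\<lambda>c. b * ?D f c)"
    if "f \<in> smooth_functions A" for f :: "'a \<Rightarrow> real" and b
    using frechet_derivative_at[OF has_derivative_mult_right[OF D[OF that(1)], of b]]
    by (simp add: scl_def)
  moreover have "?D (f * h) = (\<lambda>c. f q * ?D h c + ?D f c * h q)"
    if "f \<in> smooth_functions A" "h \<in> smooth_functions A" for f h :: "'a \<Rightarrow> real"
    using frechet_derivative_at[OF has_derivative_mult[OF D[OF that(1)] D[OF that(2)]]]
    by (simp add: inv_chart[OF U q])
  ultimately show ?thesis
    by (simp add: tangent_space_def smooth_functions_add smooth_functions_mult smooth_functions_scl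
        algebra_simps)
qed

text \<open>
  A derivation at \<open>p\<close> is a combination of the partial derivatives in a chart: multiply a function
  vanishing at \<open>p\<close> by the square of a bump function \<open>\<rho>\<close>, and Hadamard's lemma writes it as a sum of
  products of globally defined functions \<open>\<rho> * (x\<^sub>i - a\<^sub>i)\<close> and \<open>\<rho> * h\<^sub>i\<close>, on which the Leibniz rule
  determines the derivation. The partial derivative in the resulting constant direction \<open>c\<close>,
  multiplied by \<open>\<rho>\<close>, is a global vector field with the prescribed value at \<open>p\<close>.
\<close>

theorem tangent_vector_extends:
  assumes v: "v \<in> tangent_space A p"
  obtains X where "X \<in> vector_fields A" "X p = v"
proof -
  obtain U \<psi> where U: "(U, \<psi>) \<in> A" and p: "p \<in> U" by (rule chart_at)
  define a where "a = \<psi> p"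
  obtain r where r: "r > 0" and B: "ball a r \<subseteq> \<psi> ` U"
    using chart_image_open[OF U] p open_contains_ball unfolding a_def by blast
  define K where "K = cball a (r / 2)"
  have K: "compact K" "K \<subseteq> ball a r" "a \<in> K" using r unfolding K_def by auto
  obtain \<rho> :: "'e \<Rightarrow> real" where \<rho>: "smooth_on UNIV \<rho>" "\<rho> a = 1" "\<And>x. x \<notin> K \<Longrightarrow> \<rho> x = 0"
    using smooth_bump_exists[of "r / 2" a] r unfolding K_def by auto
  have \<rho>B: "smooth_on (ball a r) \<rho>" using \<rho>(1) smooth_on_subset by blast
  define E where "E u = extend_by_zero U \<psi> K (\<lambda>x. \<rho> x * u x)" for u
  have E: "E u \<in> smooth_functions A" if "smooth_on (ball a r) u" for u
    unfolding E_def
    by (rule extend_by_zero_smooth[OF U K(1,2) _ B]) (use \<rho> in \<open>auto intro: smooth_on_mult[OF open_ball \<rho>B that]\<close>)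
  have Ep: "E u p = u a" for u
    using p K(3) \<rho>(2) by (simp add: E_def extend_by_zero_def flip: a_def)
  let ?D = "\<lambda>f x. frechet_derivative (\<lambda>x. f (inv_into U \<psi> x)) (at x)"
  have lin: "smooth_on (ball a r) (\<lambda>x. (x - a) \<bullet> i)" for i
    using smooth_on_add[OF _ smooth_on_bounded_linear[OF bounded_linear_inner_left[of i]]
        smooth_on_const[of _ "- (a \<bullet> i)"]]
    by (simp add: inner_diff_left)
  define c where "c = (\<Sum>i\<in>Basis. v (E (\<lambda>x. (x - a) \<bullet> i)) *\<^sub>R i)"
  have vD: "v f = ?D f a c" if f: "f \<in> smooth_functions A" for f
  proof -
    define f\<^sub>0 where "f\<^sub>0 = f + (\<lambda>q. - f p)"
    have f\<^sub>0: "f\<^sub>0 \<in> smooth_functions A" "f\<^sub>0 p = 0"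
      unfolding f\<^sub>0_def using f smooth_functions_add smooth_functions_const by auto
    have vf\<^sub>0: "v f\<^sub>0 = v f"
      unfolding f\<^sub>0_def using tangent_add[OF v f smooth_functions_const] tangent_const[OF v] by simp
    have fB: "smooth_on (ball a r) (\<lambda>x. f (inv_into U \<psi> x))"
      using smooth_functionsD[OF f U] B smooth_on_subset by blast
    obtain h where h: "\<And>i. smooth_on (ball a r) (h i)"
      "\<And>x. x \<in> ball a r \<Longrightarrow> f (inv_into U \<psi> x) = f (inv_into U \<psi> a) + (\<Sum>i\<in>Basis. ((x - a) \<bullet> i) * h i x)"
      "\<And>i. h i a = ?D f a i"
      using hadamard_lemma[OF fB r] by auto
    have one: "E (\<lambda>_. 1) \<in> smooth_functions A" by (rule E[OF smooth_on_const])
    (* One bump factor for each of the two factors of the Hadamard products. *)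
    have "E (\<lambda>_. 1) * (E (\<lambda>_. 1) * f\<^sub>0) = (\<Sum>i\<in>Basis. E (\<lambda>x. (x - a) \<bullet> i) * E (h i))"
    proof
      fix q
      show "(E (\<lambda>_. 1) * (E (\<lambda>_. 1) * f\<^sub>0)) q = (\<Sum>i\<in>Basis. E (\<lambda>x. (x - a) \<bullet> i) * E (h i)) q"
      proof (cases "q \<in> U \<and> \<psi> q \<in> K")
        case True
        then have "f\<^sub>0 q = (\<Sum>i\<in>Basis. ((\<psi> q - a) \<bullet> i) * h i (\<psi> q))"
          using h(2)[of "\<psi> q"] K(2) inv_chart[OF U] p by (auto simp: f\<^sub>0_def a_def)
        then show ?thesis
          using True by (simp add: sum_fun_apply E_def extend_by_zero_def sum_distrib_left algebra_simps)
      next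
        case False
        then have "E u q = 0" for u by (auto simp: E_def extend_by_zero_def)
        then show ?thesis by (simp add: sum_fun_apply)
      qed
    qed
    moreover have "v (E (\<lambda>_. 1) * (E (\<lambda>_. 1) * f\<^sub>0)) = v f"
      using one f\<^sub>0 by (simp add: tangent_mult[OF v] smooth_functions_mult Ep vf\<^sub>0)
    moreover have "v (\<Sum>i\<in>Basis. E (\<lambda>x. (x - a) \<bullet> i) * E (h i)) =
        (\<Sum>i\<in>Basis. v (E (\<lambda>x. (x - a) \<bullet> i)) * ?D f a i)"
      by (subst tangent_sum[OF v])
        (auto simp: tangent_mult[OF v] smooth_functions_mult E lin h Ep intro!: sum.cong)
    moreover have "?D f a c = (\<Sum>i\<in>Basis. v (E (\<lambda>x. (x - a) \<bullet> i)) * ?D f a i)"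
    proof -
      have "linear (?D f a)"
        using smooth_on_has_derivative[OF fB] r has_derivative_linear by force
      then show ?thesis unfolding c_def by (simp add: linear_sum linear_scale)
    qed
    ultimately show ?thesis by simp
  qed
  define X where "X q f = (if f \<in> smooth_functions A then E (\<lambda>x. ?D f x c) q else 0)" for q f
  have "X q \<in> tangent_space A q" for q
  proof (cases "q \<in> U \<and> \<psi> q \<in> K")
    case True
    then have "X q = (\<lambda>f. if f \<in> smooth_functions A then \<rho> (\<psi> q) * ?D f (\<psi> q) c else 0)"
      by (auto simp: fun_eq_iff X_def E_def extend_by_zero_def)
    then show ?thesis
      using coordinate_derivation[OF U, of q "\<rho> (\<psi> q)" c] True by simp
  next
    case False
    then have "X q = 0" by (auto simp: X_def E_def extend_by_zero_def fun_eq_iff)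
    then show ?thesis using tangent_space_zero by simp
  qed
  moreover have "(\<lambda>q. X q f) \<in> smooth_functions A" if f: "f \<in> smooth_functions A" for f
    using E[OF smooth_on_subset[OF smooth_on_derivative[OF smooth_functionsD[OF f U]] B], of c] f
    by (simp add: X_def eta_contract_eq)
  moreover have "X p = v"
    using vD tangent_nonsmooth[OF v] by (auto simp: X_def Ep)
  ultimately show ?thesis using that unfolding vector_fields_def by blast
qed

end

section \<open>Curvature of the Levi-Civita connection\<close>

text \<open>
  The first Bianchi identity and the two skew symmetries imply the symmetry between the pairs. It is
  stated for an arbitrary four-argument function because it is applied a second time, to a tensor other
  than the curvature.
\<close>

lemma pair_symmetry:
  fixes R :: "'v \<Rightarrow> 'v \<Rightarrow> 'v \<Rightarrow> 'v \<Rightarrow> real"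
  assumes skew12: "\<And>x y z w. x \<in> S \<Longrightarrow> y \<in> S \<Longrightarrow> z \<in> S \<Longrightarrow> w \<in> S \<Longrightarrow> R x y z w = - R y x z w"
    and skew34: "\<And>x y z w. x \<in> S \<Longrightarrow> y \<in> S \<Longrightarrow> z \<in> S \<Longrightarrow> w \<in> S \<Longrightarrow> R x y z w = - R x y w z"
    and bianchi: "\<And>x y z w. x \<in> S \<Longrightarrow> y \<in> S \<Longrightarrow> z \<in> S \<Longrightarrow> w \<in> S \<Longrightarrow>
      R x y z w + R y z x w + R z x y w = 0"
    and S: "x \<in> S" "y \<in> S" "z \<in> S" "w \<in> S"
  shows "R x y z w = R z w x y"
proof -
  (* Up to skew symmetry, the sum of the first two identities and the sum of the last two both contain
     R z x y w + R w y z x; the remaining terms are R x y z w - R z w x y and its negative. *)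
  show ?thesis
    using bianchi[OF S(1,2,3,4)] bianchi[OF S(2,3,4,1)] bianchi[OF S(3,4,1,2)] bianchi[OF S(4,1,2,3)]
      skew34[OF S(1,2,4,3)] skew34[OF S(2,3,4,1)] skew34[OF S(3,4,2,1)] skew34[OF S(4,1,3,2)]
      skew12[OF S(1,3,4,2)] skew34[OF S(3,1,4,2)] skew12[OF S(4,2,3,1)] skew34[OF S(2,4,3,1)]
    by linarith
qed

locale levi_civita_manifold = smooth_manifold A
  for A :: "('a::t2_space, 'e::euclidean_space) chart set" +
  fixes g :: "'a \<Rightarrow> 'a tvec \<Rightarrow> 'a tvec \<Rightarrow> real"
    and D :: "'a vfield \<Rightarrow> 'a vfield \<Rightarrow> 'a vfield"
  assumes metric: "pseudo_riemannian_metric A g"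
    and levi_civita: "levi_civita_connection A g D"
begin

lemma
  assumes "u \<in> tangent_space A p" "v \<in> tangent_space A p" "w \<in> tangent_space A p"
  shows g_add_left: "g p (u + v) w = g p u w + g p v w"
    and g_add_right: "g p w (u + v) = g p w u + g p w v"
  using metric assms tangent_space_add unfolding pseudo_riemannian_metric_def by metis+

lemma
  assumes "v \<in> tangent_space A p" "w \<in> tangent_space A p"
  shows g_scl_left: "g p (c \<odot> v) w = c * g p v w"
    and g_scl_right: "g p w (c \<odot> v) = c * g p w v"
    and g_sym: "g p v w = g p w v"
  using metric assms tangent_space_scl unfolding pseudo_riemannian_metric_def by metis+

lemma
  assumes "u \<in> tangent_space A p" "v \<in> tangent_space A p" "w \<in> tangent_space A p"
  shows g_diff_left: "g p (u - v) w = g p u w - g p v w"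
    and g_diff_right: "g p w (u - v) = g p w u - g p w v"
  unfolding fun_diff_eq_add_scl[of u] using assms
  by (simp_all only: g_add_left g_add_right g_scl_left g_scl_right tangent_space_scl)

text \<open>
  Nondegeneracy of the metric is a statement about tangent vectors, while curvature identities are
  about vector fields. Extending tangent vectors to vector fields connects the two.
\<close>

lemma zero_eqI:
  assumes v: "v \<in> tangent_space A p" and "\<And>Z. Z \<in> vector_fields A \<Longrightarrow> g p v (Z p) = 0"
  shows "v = 0"
proof -
  have "g p v w = 0" if "w \<in> tangent_space A p" for w
    using tangent_vector_extends[OF that] assms(2) by metis
  then show ?thesis using metric v unfolding pseudo_riemannian_metric_def by blast
qed

lemma tangent_eqI:
  assumes "v \<in> tangent_space A p" "w \<in> tangent_space A p"
    and "\<And>Z. Z \<in> vector_fields A \<Longrightarrow> g p v (Z p) = g p w (Z p)"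
  shows "v = w"
  using zero_eqI[of "v - w" p] assms by (simp add: tangent_space_diff g_diff_left field_at)

lemma g_smooth:
  "X \<in> vector_fields A \<Longrightarrow> Y \<in> vector_fields A \<Longrightarrow> (\<lambda>p. g p (X p) (Y p)) \<in> smooth_functions A"
  using metric unfolding pseudo_riemannian_metric_def by blast

lemma D_field: "X \<in> vector_fields A \<Longrightarrow> Y \<in> vector_fields A \<Longrightarrow> D X Y \<in> vector_fields A"
  using levi_civita unfolding levi_civita_connection_def affine_connection_def by blast

lemma
  assumes "X \<in> vector_fields A" "Y \<in> vector_fields A" "Z \<in> vector_fields A"
  shows D_diff_left: "D (X - Y) Z = D X Z - D Y Z"
    and D_diff_right: "D Z (X - Y) = D Z X - D Z Y"
proof -
  have "D ((X - Y) + Y) Z = D (X - Y) Z + D Y Z" "D Z ((X - Y) + Y) = D Z (X - Y) + D Z Y"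
    using levi_civita assms fields_diff[OF assms(1,2)]
    unfolding levi_civita_connection_def affine_connection_def by blast+
  then show "D (X - Y) Z = D X Z - D Y Z" "D Z (X - Y) = D Z X - D Z Y"
    by (simp_all add: algebra_simps)
qed

lemma torsion_free:
  "X \<in> vector_fields A \<Longrightarrow> Y \<in> vector_fields A \<Longrightarrow> lie_bracket X Y = D X Y - D Y X"
  using levi_civita unfolding levi_civita_connection_def by simp

lemma metric_compatible:
  "X \<in> vector_fields A \<Longrightarrow> Y \<in> vector_fields A \<Longrightarrow> Z \<in> vector_fields A \<Longrightarrow>
    X p (\<lambda>q. g q (Y q) (Z q)) = g p (D X Y p) (Z p) + g p (Y p) (D X Z p)"
  using levi_civita unfolding levi_civita_connection_def by blast

lemma bracket_field:
  "X \<in> vector_fields A \<Longrightarrow> Y \<in> vector_fields A \<Longrightarrow> lie_bracket X Y \<in> vector_fields A"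
  by (simp add: torsion_free fields_diff D_field)

lemma curvature_field:
  "X \<in> vector_fields A \<Longrightarrow> Y \<in> vector_fields A \<Longrightarrow> Z \<in> vector_fields A \<Longrightarrow>
    curvature D X Y Z \<in> vector_fields A"
  by (simp add: curvature_def fields_diff D_field bracket_field)

lemma field_double_apply_diff:
  assumes "X \<in> vector_fields A" "Y \<in> vector_fields A" "Z \<in> vector_fields A" "f \<in> smooth_functions A"
  shows "X p (\<lambda>q. lie_bracket Y Z q f) =
    X p (\<lambda>q. Y q (\<lambda>s. Z s f)) - X p (\<lambda>q. Z q (\<lambda>s. Y s f))"
  using tangent_diff[OF field_at[OF assms(1)], of "\<lambda>q. Y q (\<lambda>s. Z s f)" "\<lambda>q. Z q (\<lambda>s. Y s f)" p]
    assms by (simp add: lie_bracket_def field_apply_smooth fun_diff_def)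

lemma jacobi_identity:
  assumes "X \<in> vector_fields A" "Y \<in> vector_fields A" "Z \<in> vector_fields A"
  shows "lie_bracket X (lie_bracket Y Z) + lie_bracket Y (lie_bracket Z X)
    + lie_bracket Z (lie_bracket X Y) = 0"
proof (intro ext)
  fix p and f :: "'a \<Rightarrow> real"
  show "(lie_bracket X (lie_bracket Y Z) + lie_bracket Y (lie_bracket Z X)
    + lie_bracket Z (lie_bracket X Y)) p f = (0 :: 'a vfield) p f"
  proof (cases "f \<in> smooth_functions A")
    case True
    have *: "lie_bracket X (lie_bracket Y Z) p f = X p (\<lambda>q. Y q (\<lambda>s. Z s f)) - X p (\<lambda>q. Z q (\<lambda>s. Y s f))
        - (Y p (\<lambda>q. Z q (\<lambda>s. X s f)) - Z p (\<lambda>q. Y q (\<lambda>s. X s f)))"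
      if "X \<in> vector_fields A" "Y \<in> vector_fields A" "Z \<in> vector_fields A" for X Y Z
      using field_double_apply_diff[OF that True]
      by (subst lie_bracket_def) (simp add: lie_bracket_def)
    show ?thesis
      by (simp add: *[OF assms] *[OF assms(2,3,1)] *[OF assms(3,1,2)])
  next
    case False
    have *: "lie_bracket X Y p f = 0" if "X \<in> vector_fields A" "Y \<in> vector_fields A" for X Y
      using tangent_nonsmooth[OF field_at[OF bracket_field[OF that]] False] .
    show ?thesis using assms by (simp add: * bracket_field)
  qed
qed

lemma curvature_skew12:
  assumes "X \<in> vector_fields A" "Y \<in> vector_fields A" "Z \<in> vector_fields A"
  shows "curvature D X Y Z = - curvature D Y X Z"
  using assms by (simp add: curvature_def torsion_free D_diff_left D_field)

lemma curvature_bianchi: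
  assumes "X \<in> vector_fields A" "Y \<in> vector_fields A" "Z \<in> vector_fields A"
  shows "curvature D X Y Z + curvature D Y Z X + curvature D Z X Y = 0"
proof -
  have *: "D X (D Y Z) - D X (D Z Y) - D (lie_bracket Y Z) X = lie_bracket X (lie_bracket Y Z)"
    if "X \<in> vector_fields A" "Y \<in> vector_fields A" "Z \<in> vector_fields A" for X Y Z
    using that by (simp add: torsion_free[of X] bracket_field)
      (simp add: torsion_free D_diff_right D_field)
  have "curvature D X Y Z + curvature D Y Z X + curvature D Z X Y =
    (D X (D Y Z) - D X (D Z Y) - D (lie_bracket Y Z) X) +
    (D Y (D Z X) - D Y (D X Z) - D (lie_bracket Z X) Y) +
    (D Z (D X Y) - D Z (D Y X) - D (lie_bracket X Y) Z)"
    by (simp add: curvature_def algebra_simps)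
  also have "\<dots> = 0"
    unfolding *[OF assms] *[OF assms(2,3,1)] *[OF assms(3,1,2)] by (rule jacobi_identity[OF assms])
  finally show ?thesis .
qed

definition Rm :: "'a \<Rightarrow> 'a vfield \<Rightarrow> 'a vfield \<Rightarrow> 'a vfield \<Rightarrow> 'a vfield \<Rightarrow> real"
  where "Rm p X Y Z W = g p (curvature D X Y Z p) (W p)"

lemma Rm_skew12:
  assumes "X \<in> vector_fields A" "Y \<in> vector_fields A" "Z \<in> vector_fields A" "W \<in> vector_fields A"
  shows "Rm p X Y Z W = - Rm p Y X Z W"
proof -
  have "curvature D X Y Z p = (-1) \<odot> curvature D Y X Z p"
    using curvature_skew12[OF assms(1-3)] by (auto simp: scl_def)
  then show ?thesis
    using assms by (simp add: Rm_def g_scl_left field_at curvature_field)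
qed

lemma Rm_bianchi:
  assumes "X \<in> vector_fields A" "Y \<in> vector_fields A" "Z \<in> vector_fields A" "W \<in> vector_fields A"
  shows "Rm p X Y Z W + Rm p Y Z X W + Rm p Z X Y W = 0"
proof -
  have "curvature D X Y Z p + curvature D Y Z X p + curvature D Z X Y p = 0 \<odot> W p"
    using fun_cong[OF curvature_bianchi[OF assms(1-3)], of p] by (auto simp: scl_def fun_eq_iff)
  then have "g p (curvature D X Y Z p + curvature D Y Z X p + curvature D Z X Y p) (W p) = 0"
    using assms by (simp add: g_scl_left field_at)
  then show ?thesis
    using assms by (simp add: Rm_def g_add_left field_at curvature_field tangent_space_add)
qed

text \<open>
  Second derivatives of \<open>g (Z, W)\<close> along \<open>X\<close> and \<open>Y\<close> satisfy \<open>X Y - Y X = [X, Y]\<close>. Expanding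
  both sides by metric compatibility, the mixed terms \<open>g (D X Z, D Y W)\<close> cancel and what is left
  says that \<open>g (R(X, Y) Z, W) + g (Z, R(X, Y) W) = 0\<close>.
\<close>

lemma Rm_skew34:
  assumes V: "X \<in> vector_fields A" "Y \<in> vector_fields A" "Z \<in> vector_fields A" "W \<in> vector_fields A"
  shows "Rm p X Y Z W = - Rm p X Y W Z"
proof -
  let ?f = "\<lambda>q. g q (Z q) (W q)"
  have *: "X p (\<lambda>q. Y q ?f) = g p (D X (D Y Z) p) (W p) + g p (D Y Z p) (D X W p)
      + (g p (D X Z p) (D Y W p) + g p (Z p) (D X (D Y W) p))"
    if "X \<in> vector_fields A" "Y \<in> vector_fields A" for X Y
  proof -
    have "(\<lambda>q. Y q ?f) = (\<lambda>q. g q (D Y Z q) (W q)) + (\<lambda>q. g q (Z q) (D Y W q))"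
      using that V by (auto simp: metric_compatible)
    then have "X p (\<lambda>q. Y q ?f) = X p (\<lambda>q. g q (D Y Z q) (W q)) + X p (\<lambda>q. g q (Z q) (D Y W q))"
      using that V by (simp add: tangent_add[OF field_at] g_smooth D_field)
    then show ?thesis using that V by (simp add: metric_compatible D_field)
  qed
  have "lie_bracket X Y p ?f = X p (\<lambda>q. Y q ?f) - Y p (\<lambda>q. X q ?f)"
    by (simp add: lie_bracket_def)
  then have "g p (D (lie_bracket X Y) Z p) (W p) + g p (Z p) (D (lie_bracket X Y) W p) =
      g p (D X (D Y Z) p) (W p) + g p (Z p) (D X (D Y W) p)
      - g p (D Y (D X Z) p) (W p) - g p (Z p) (D Y (D X W) p)"
    using *[OF V(1,2)] *[OF V(2,1)] metric_compatible[OF bracket_field[OF V(1,2)] V(3,4), of p]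
    by linarith
  moreover have "g p (curvature D X Y W p) (Z p) = g p (Z p) (curvature D X Y W p)"
    using V by (intro g_sym field_at curvature_field)
  ultimately show ?thesis
    using V by (simp add: Rm_def curvature_def g_diff_left g_diff_right field_at D_field
        bracket_field fields_diff tangent_space_diff)
qed

lemmas Rm_pair_symmetry =
  pair_symmetry[of "vector_fields A" "Rm p" for p, OF Rm_skew12 Rm_skew34 Rm_bianchi]

end

section \<open>Parallel self-adjoint endomorphisms\<close>

locale parallel_endomorphism = levi_civita_manifold A g D
  for A :: "('a::t2_space, 'e::euclidean_space) chart set" and g D +
  fixes \<phi> :: "'a \<Rightarrow> 'a tvec \<Rightarrow> 'a tvec"
  assumes endo: "endo_field A \<phi>"
    and covd_zero: "\<And>X Y Z. X \<in> vector_fields A \<Longrightarrow> Y \<in> vector_fields A \<Longrightarrow> Z \<in> vector_fields A \<Longrightarrow>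
      fundamental_tensor g D \<phi> X Y Z = 0"
begin

abbreviation \<Phi> :: "'a vfield \<Rightarrow> 'a vfield"
  where "\<Phi> X \<equiv> \<lambda>p. \<phi> p (X p)"

lemma \<phi>_tangent: "v \<in> tangent_space A p \<Longrightarrow> \<phi> p v \<in> tangent_space A p"
  using endo unfolding endo_field_def by blast

lemma \<Phi>_field: "X \<in> vector_fields A \<Longrightarrow> \<Phi> X \<in> vector_fields A"
  using endo unfolding endo_field_def by blast

lemma \<phi>_diff:
  assumes "v \<in> tangent_space A p" "w \<in> tangent_space A p"
  shows "\<phi> p (v - w) = \<phi> p v - \<phi> p w"
proof -
  have "\<phi> p ((v - w) + w) = \<phi> p (v - w) + \<phi> p w"
    using endo assms tangent_space_diff[OF assms] unfolding endo_field_def by blast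
  then show ?thesis by (simp add: algebra_simps)
qed

lemma D_commutes:
  assumes "X \<in> vector_fields A" "Y \<in> vector_fields A"
  shows "D X (\<Phi> Y) = \<Phi> (D X Y)"
proof
  fix p
  have "covd_endo D \<phi> X Y p = 0"
  proof (rule zero_eqI)
    show "covd_endo D \<phi> X Y p \<in> tangent_space A p"
      using assms by (simp add: covd_endo_def tangent_space_diff field_at D_field \<Phi>_field \<phi>_tangent)
    show "g p (covd_endo D \<phi> X Y p) (Z p) = 0" if "Z \<in> vector_fields A" for Z
      using fun_cong[OF covd_zero[OF assms that], of p] by (simp add: fundamental_tensor_def)
  qed
  then show "D X (\<Phi> Y) p = \<phi> p (D X Y p)" by (simp add: covd_endo_def)
qed

lemma curvature_commutes:
  assumes "X \<in> vector_fields A" "Y \<in> vector_fields A" "Z \<in> vector_fields A"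
  shows "curvature D X Y (\<Phi> Z) p = \<phi> p (curvature D X Y Z p)"
  using assms by (simp add: curvature_def D_commutes D_field bracket_field \<phi>_diff field_at
      tangent_space_diff)

end

locale parallel_selfadjoint_endomorphism = parallel_endomorphism +
  assumes selfadjoint: "\<And>p v w. v \<in> tangent_space A p \<Longrightarrow> w \<in> tangent_space A p \<Longrightarrow>
    g p (\<phi> p v) w = g p v (\<phi> p w)"
begin

lemma Rm_shift34:
  assumes "X \<in> vector_fields A" "Y \<in> vector_fields A" "Z \<in> vector_fields A" "W \<in> vector_fields A"
  shows "Rm p X Y (\<Phi> Z) W = Rm p X Y Z (\<Phi> W)"
  using assms by (simp add: Rm_def curvature_commutes selfadjoint field_at curvature_field)

text \<open>
  \<open>R(X, Y, Z, \<phi> W)\<close> is again skew in \<open>Z, W\<close> because \<open>\<phi>\<close> is self-adjoint and commutes with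
  \<open>R(X, Y)\<close>; the Bianchi identity is inherited with \<open>\<phi> W\<close> in the last slot. So it has
  the pair symmetry too. Combined with the pair symmetry of \<open>R\<close> itself, this lets \<open>\<phi>\<close> move from any
  slot of \<open>R\<close> to any other.
\<close>

lemma twisted_Rm_pair_symmetry:
  assumes "X \<in> vector_fields A" "Y \<in> vector_fields A" "Z \<in> vector_fields A" "W \<in> vector_fields A"
  shows "Rm p X Y Z (\<Phi> W) = Rm p Z W X (\<Phi> Y)"
proof (rule pair_symmetry[of "vector_fields A" "\<lambda>X Y Z W. Rm p X Y Z (\<Phi> W)", OF _ _ _ assms])
  fix X Y Z W
  assume V: "X \<in> vector_fields A" "Y \<in> vector_fields A" "Z \<in> vector_fields A" "W \<in> vector_fields A"
  show "Rm p X Y Z (\<Phi> W) = - Rm p Y X Z (\<Phi> W)"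
    using Rm_skew12 V \<Phi>_field by blast
  show "Rm p X Y Z (\<Phi> W) = - Rm p X Y W (\<Phi> Z)"
    using Rm_skew34[of X Y "\<Phi> Z" W p] Rm_shift34[of X Y Z W p] V \<Phi>_field by simp
  show "Rm p X Y Z (\<Phi> W) + Rm p Y Z X (\<Phi> W) + Rm p Z X Y (\<Phi> W) = 0"
    using Rm_bianchi V \<Phi>_field by blast
qed

lemma Rm_shift24:
  assumes "X \<in> vector_fields A" "Y \<in> vector_fields A" "Z \<in> vector_fields A" "W \<in> vector_fields A"
  shows "Rm p X (\<Phi> Y) Z W = Rm p X Y Z (\<Phi> W)"
  using Rm_pair_symmetry[of X "\<Phi> Y" Z W p] twisted_Rm_pair_symmetry[OF assms] assms \<Phi>_field by simp

lemma Rm_shift14: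
  assumes "X \<in> vector_fields A" "Y \<in> vector_fields A" "Z \<in> vector_fields A" "W \<in> vector_fields A"
  shows "Rm p (\<Phi> X) Y Z W = Rm p X Y Z (\<Phi> W)"
  using Rm_skew12[of "\<Phi> X" Y Z W p] Rm_skew12[of X Y Z "\<Phi> W" p] Rm_shift24[of Y X Z W p]
    assms \<Phi>_field by simp

end

text \<open>
  In \<open>R(X, Y, \<phi> \<psi> Z, W)\<close> each of the two endomorphisms can be moved to any slot. Parking
  them in different slots and bringing them back in the other order shows that their order is immaterial,
  although \<open>\<phi>\<close> and \<open>\<psi>\<close> need not commute on the tangent space.
\<close>

lemma parallel_selfadjoint_commute_on_curvature:
  assumes "parallel_selfadjoint_endomorphism A g D \<phi>" "parallel_selfadjoint_endomorphism A g D \<psi>"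
    and V: "X \<in> vector_fields A" "Y \<in> vector_fields A" "Z \<in> vector_fields A"
  shows "\<phi> p (\<psi> p (curvature D X Y Z p)) = \<psi> p (\<phi> p (curvature D X Y Z p))"
proof -
  interpret P: parallel_selfadjoint_endomorphism A g D \<phi> by fact
  interpret Q: parallel_selfadjoint_endomorphism A g D \<psi> by fact
  have eq: "P.Rm p X Y (P.\<Phi> (Q.\<Phi> Z)) W = P.Rm p X Y (Q.\<Phi> (P.\<Phi> Z)) W" if W: "W \<in> vector_fields A" for W
  proof -
    note F = V W P.\<Phi>_field Q.\<Phi>_field
    have "P.Rm p X Y (P.\<Phi> (Q.\<Phi> Z)) W = P.Rm p X Y (Q.\<Phi> Z) (P.\<Phi> W)"
      by (intro P.Rm_shift34 F)
    also have "\<dots> = P.Rm p X (P.\<Phi> Y) (Q.\<Phi> Z) W"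
      by (intro P.Rm_shift24[symmetric] F)
    also have "\<dots> = P.Rm p X (P.\<Phi> Y) Z (Q.\<Phi> W)"
      by (intro Q.Rm_shift34 F)
    also have "\<dots> = P.Rm p (Q.\<Phi> X) (P.\<Phi> Y) Z W"
      by (intro Q.Rm_shift14[symmetric] F)
    also have "\<dots> = P.Rm p (Q.\<Phi> X) Y Z (P.\<Phi> W)"
      by (intro P.Rm_shift24 F)
    also have "\<dots> = P.Rm p (Q.\<Phi> X) Y (P.\<Phi> Z) W"
      by (intro P.Rm_shift34[symmetric] F)
    also have "\<dots> = P.Rm p X Y (P.\<Phi> Z) (Q.\<Phi> W)"
      by (intro Q.Rm_shift14 F)
    also have "\<dots> = P.Rm p X Y (Q.\<Phi> (P.\<Phi> Z)) W"
      by (intro Q.Rm_shift34[symmetric] F)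
    finally show ?thesis .
  qed
  have T: "curvature D X Y Z' p \<in> tangent_space A p" if "Z' \<in> vector_fields A" for Z'
    by (intro P.field_at[of "curvature D X Y Z'"] P.curvature_field V that)
  have "curvature D X Y (P.\<Phi> (Q.\<Phi> Z)) p = curvature D X Y (Q.\<Phi> (P.\<Phi> Z)) p"
  proof (rule P.tangent_eqI)
    show "curvature D X Y (P.\<Phi> (Q.\<Phi> Z)) p \<in> tangent_space A p"
      "curvature D X Y (Q.\<Phi> (P.\<Phi> Z)) p \<in> tangent_space A p"
      by (intro T P.\<Phi>_field Q.\<Phi>_field V)+
  qed (rule eq[unfolded P.Rm_def])
  then show ?thesis
    using V by (simp add: P.curvature_commutes Q.curvature_commutes P.\<Phi>_field Q.\<Phi>_field)
qed

section \<open>Almost contact 3-structures\<close>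

lemma
  assumes "almost_contact_3_structure A \<phi> \<xi> \<eta>" and v: "v \<in> tangent_space A p"
  shows \<phi>2\<phi>3: "\<phi> 2 p (\<phi> 3 p v) = \<eta> 3 p v \<odot> \<xi> 2 p + \<phi> 1 p v"
    and \<phi>3\<phi>2: "\<phi> 3 p (\<phi> 2 p v) = \<eta> 2 p v \<odot> \<xi> 3 p - \<phi> 1 p v"
    and \<phi>\<phi>_self: "\<alpha> \<in> {1, 2, 3} \<Longrightarrow> \<phi> \<alpha> p (\<phi> \<alpha> p v) = \<eta> \<alpha> p v \<odot> \<xi> \<alpha> p - v"
    and \<phi>\<xi>_self: "\<alpha> \<in> {1, 2, 3} \<Longrightarrow> \<phi> \<alpha> p (\<xi> \<alpha> p) = 0"
    and \<eta>3\<xi>1: "\<eta> 3 p (\<xi> 1 p) = 0"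
    and \<eta>\<phi>_self: "\<alpha> \<in> {1, 2, 3} \<Longrightarrow> \<eta> \<alpha> p (\<phi> \<alpha> p v) = 0"
    and \<eta>\<phi>: "\<eta> 1 p (\<phi> 2 p v) = \<eta> 3 p v" "\<eta> 1 p (\<phi> 3 p v) = - \<eta> 2 p v"
      "\<eta> 2 p (\<phi> 3 p v) = \<eta> 1 p v" "\<eta> 3 p (\<phi> 2 p v) = - \<eta> 1 p v"
  using assms unfolding almost_contact_3_structure_def
  by (auto simp: kronecker_def levi_civita_symbol_def scl_def fun_eq_iff)


text \<open>
  \<open>\<phi>\<^sub>2 \<phi>\<^sub>3\<close> and \<open>\<phi>\<^sub>3 \<phi>\<^sub>2\<close> are \<open>\<phi>\<^sub>1\<close> and \<open>- \<phi>\<^sub>1\<close> up to multiples of the Reeb vectors.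
  If they agree on \<open>v\<close>, then applying \<open>\<eta>\<^sub>2\<close> and \<open>\<eta>\<^sub>3\<close> removes these multiples, so \<open>\<phi>\<^sub>1 v = 0\<close>,
  and \<open>v\<close> lies in the kernel of \<open>\<phi>\<^sub>1\<close>, which is spanned by \<open>\<xi>\<^sub>1\<close>.
\<close>

lemma commuting_on_vector:
  assumes S: "almost_contact_3_structure A \<phi> \<xi> \<eta>" and v: "v \<in> tangent_space A p"
    and comm: "\<phi> 2 p (\<phi> 3 p v) = \<phi> 3 p (\<phi> 2 p v)"
  shows "v = \<eta> 1 p v \<odot> \<xi> 1 p"
proof -
  have T: "\<phi> \<alpha> p w \<in> tangent_space A p" if "\<alpha> \<in> {1, 2, 3}" "w \<in> tangent_space A p" for \<alpha> w
    using S that unfolding almost_contact_3_structure_def endo_field_def by blast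
  have T2: "\<phi> 2 p v \<in> tangent_space A p" and T3: "\<phi> 3 p v \<in> tangent_space A p" 
    using T v by auto
  have "\<eta> 3 p v = \<eta> 2 p (\<phi> 3 p (\<phi> 2 p v))"
    using \<eta>\<phi>(1)[OF S v] \<eta>\<phi>(3)[OF S T2] by simp
  also have "\<dots> = 0"
    unfolding comm[symmetric] by (rule \<eta>\<phi>_self[OF S T3]) simp
  finally have e3: "\<eta> 3 p v = 0" .
  have "\<eta> 2 p v = \<eta> 3 p (\<phi> 2 p (\<phi> 3 p v))"
    using \<eta>\<phi>(2)[OF S v] \<eta>\<phi>(4)[OF S T3] by simp
  also have "\<dots> = 0"
    unfolding comm by (rule \<eta>\<phi>_self[OF S T2]) simp
  finally have e2: "\<eta> 2 p v = 0" .
  have "\<phi> 1 p v = - \<phi> 1 p v"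
    using comm unfolding \<phi>2\<phi>3[OF S v] \<phi>3\<phi>2[OF S v] e2 e3 by (simp add: scl_def fun_eq_iff)
  then have z: "\<phi> 1 p v = 0 \<odot> v"
    by (simp add: scl_def fun_eq_iff)
  have "\<phi> 1 p (0 \<odot> v) = 0 \<odot> \<phi> 1 p v"
    using S v unfolding almost_contact_3_structure_def endo_field_def by blast
  then have "\<phi> 1 p (\<phi> 1 p v) = 0"
    unfolding z by (simp add: scl_def fun_eq_iff)
  then show ?thesis
    using \<phi>\<phi>_self[OF S v, of 1] by simp
qed

text \<open>
  For a metric that is anti-Hermitian with respect to \<open>\<phi>\<close>, replacing \<open>w\<close> by \<open>\<phi> w\<close> in the
  compatibility condition and using \<open>\<phi> \<phi> w = \<eta> w \<xi> - w\<close> turns the sign \<open>-1\<close> into self-adjointness.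
  The correction terms vanish, as \<open>\<eta> \<circ> \<phi> = 0\<close> and the image of \<open>\<phi>\<close> is orthogonal to \<open>\<xi>\<close>.
\<close>

lemma (in levi_civita_manifold) norden_selfadjoint:
  assumes S: "almost_contact_3_structure A \<phi> \<xi> \<eta>" and H: "hermitian_norden_type A \<phi> \<eta> g"
    and \<alpha>: "\<alpha> \<in> {2, 3}" and v: "v \<in> tangent_space A p" and w: "w \<in> tangent_space A p"
  shows "g p (\<phi> \<alpha> p v) w = g p v (\<phi> \<alpha> p w)"
proof -
  have \<alpha>': "\<alpha> \<in> {1, 2, 3}" using \<alpha> by blast
  have T: "\<phi> \<alpha> p w \<in> tangent_space A p" if "w \<in> tangent_space A p" for w
    using S \<alpha>' that unfolding almost_contact_3_structure_def endo_field_def by blast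
  have \<xi>: "\<xi> \<alpha> p \<in> tangent_space A p"
    using S \<alpha>' field_at unfolding almost_contact_3_structure_def by blast
  have G: "g p (\<phi> \<alpha> p x) (\<phi> \<alpha> p y) = - g p x y + \<eta> \<alpha> p x * \<eta> \<alpha> p y"
    if "x \<in> tangent_space A p" "y \<in> tangent_space A p" for x y
    using H \<alpha> that unfolding hermitian_norden_type_def hn_sign_def by auto
  have "g p x 0 = 0" if "x \<in> tangent_space A p" for x
    using g_diff_right[OF that that that] by simp
  then have \<xi>0: "g p (\<phi> \<alpha> p v) (\<xi> \<alpha> p) = 0"
    using G[OF T[OF v] \<xi>] \<eta>\<phi>_self[OF S v \<alpha>'] \<phi>\<xi>_self[OF S v \<alpha>'] T v by simp
  have "g p (\<phi> \<alpha> p v) (\<eta> \<alpha> p w \<odot> \<xi> \<alpha> p - w) = - g p v (\<phi> \<alpha> p w)"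
    using G[OF v T[OF w]] \<phi>\<phi>_self[OF S w \<alpha>'] \<eta>\<phi>_self[OF S w \<alpha>'] by simp
  moreover have "g p (\<phi> \<alpha> p v) (\<eta> \<alpha> p w \<odot> \<xi> \<alpha> p - w) = - g p (\<phi> \<alpha> p v) w"
    using T v w \<xi> \<xi>0 by (simp add: g_diff_right g_scl_right tangent_space_scl)
  ultimately show ?thesis by simp
qed

theorem proposition14p3:
  fixes A :: "('a::{t2_space, second_countable_topology}, 'e::euclidean_space) chart set"
    and \<phi> :: "nat \<Rightarrow> 'a \<Rightarrow> 'a tvec \<Rightarrow> 'a tvec"
    and \<xi> :: "nat \<Rightarrow> 'a vfield"
    and \<eta> :: "nat \<Rightarrow> 'a \<Rightarrow> 'a tvec \<Rightarrow> real"
    and g :: "'a \<Rightarrow> 'a tvec \<Rightarrow> 'a tvec \<Rightarrow> real"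
    and D :: "'a vfield \<Rightarrow> 'a vfield \<Rightarrow> 'a vfield"
    and n :: nat
  assumes "smooth_atlas A" and "DIM('e) = 4 * n + 3"
    and "almost_contact_3_structure A \<phi> \<xi> \<eta>"
    and "pseudo_riemannian_metric A g"
    and "hermitian_norden_type A \<phi> \<eta> g"
    and "levi_civita_connection A g D"
    and "cosymplectic A \<phi> g D"
  shows "flat_connection A D"
proof -
  note S = assms(3)
  interpret levi_civita_manifold A g D
    by unfold_locales (fact assms)+
  have par: "parallel_selfadjoint_endomorphism A g D (\<phi> \<alpha>)" if "\<alpha> \<in> {2, 3}" for \<alpha>
  proof unfold_locales
    show "endo_field A (\<phi> \<alpha>)"
      using S that unfolding almost_contact_3_structure_def by blast
    show "fundamental_tensor g D (\<phi> \<alpha>) X Y Z = 0"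
      if "X \<in> vector_fields A" "Y \<in> vector_fields A" "Z \<in> vector_fields A" for X Y Z
      using assms(7) \<open>\<alpha> \<in> {2, 3}\<close> that unfolding cosymplectic_def by blast
    show "g p (\<phi> \<alpha> p v) w = g p v (\<phi> \<alpha> p w)"
      if "v \<in> tangent_space A p" "w \<in> tangent_space A p" for p v w
      using norden_selfadjoint[OF S assms(5) \<open>\<alpha> \<in> {2, 3}\<close> that] .
  qed
  interpret P2: parallel_selfadjoint_endomorphism A g D "\<phi> 2" by (rule par) simp
  have line: "curvature D X Y Z p = \<eta> 1 p (curvature D X Y Z p) \<odot> \<xi> 1 p"
    if "X \<in> vector_fields A" "Y \<in> vector_fields A" "Z \<in> vector_fields A" for X Y Z p
    using commuting_on_vector[OF S field_at[OF curvature_field[OF that]]]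
      parallel_selfadjoint_commute_on_curvature[OF par par that] by simp
  have "curvature D X Y Z p = 0"
    if V: "X \<in> vector_fields A" "Y \<in> vector_fields A" "Z \<in> vector_fields A" for X Y Z p
  proof -
    let ?v = "curvature D X Y Z p"
    have v: "?v \<in> tangent_space A p" by (intro field_at curvature_field V)
    (* \<phi> 2 maps the multiple c of \<xi> 1 to -c times \<xi> 3; being a curvature value again, the image is
       also a multiple of \<xi> 1, which forces c = 0. *)
    have "\<phi> 2 p ?v = \<eta> 1 p (\<phi> 2 p ?v) \<odot> \<xi> 1 p"
      using line[OF V(1,2) P2.\<Phi>_field[OF V(3)], of p] unfolding P2.curvature_commutes[OF V] .
    then have "\<eta> 3 p (\<phi> 2 p ?v) = \<eta> 3 p (\<eta> 1 p (\<phi> 2 p ?v) \<odot> \<xi> 1 p)"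
      by (rule arg_cong)
    moreover have "\<eta> 3 p (c \<odot> \<xi> 1 p) = 0" for c
    proof -
      have "\<xi> 1 p \<in> tangent_space A p"
        using S field_at unfolding almost_contact_3_structure_def by blast
      then have "\<eta> 3 p (c \<odot> \<xi> 1 p) = c * \<eta> 3 p (\<xi> 1 p)"
        using S unfolding almost_contact_3_structure_def one_form_def by blast
      then show ?thesis using \<eta>3\<xi>1[OF S v] by simp
    qed
    ultimately have "\<eta> 3 p (\<phi> 2 p ?v) = 0" by (rule trans)
    then have "\<eta> 1 p ?v = 0" using \<eta>\<phi>(4)[OF S v] by simp
    then have "\<eta> 1 p ?v \<odot> \<xi> 1 p = 0" by (simp add: scl_def fun_eq_iff)
    with line[OF V] show ?thesis by (rule trans)
  qed
  then show ?thesis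
    unfolding flat_connection_def by (intro ballI ext) simp
qed

end
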